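(* Let $q$ be a prime power and let $\ell, m, n$ be positive integers with $\max(\ell, n) \leq m$. Let $(\bm{A}, \bm{B}, \bm{C}, \pi)$ be the output of $\mathsf{GenIPKP}(q,\ell,m,n)$, i.e.\ $\bm{A}$ is uniformly random in $\mathbb{F}_q^{\ell \times m, \ell}$, $\bm{B}$ is uniformly random in $\mathbb{F}_q^{m \times n, n}$, $\pi$ is uniformly random in $\mathbb{S}_m$ (all independent), and $\bm{C} = \bm{A}\bm{\pi}\bm{B}$. Then \[ \mathbb{E}\big[N_{\mathsf{sol}}(\bm{A}, \bm{B}, \bm{C})\big] = \sum_{k=1}^m |\mathbb{S}_{m,k}| \sum_{r=0}^{\min(\ell, m - k)} \frac{|\mathbb{F}_q^{\ell \times (m-k), r}| \, |\mathbb{F}_q^{(\ell-r) \times k, \ell - r}| \, q^{k r}}{|\mathbb{F}_q^{\ell \times m, \ell}|} \prod_{i=0}^{n - 1} \frac{q^{m - r} - q^i}{q^m - q^i}. \]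
   Context: $\mathbb{F}_q$ is the finite field with $q$ elements. For integers $a,b,r\ge 0$, $\mathbb{F}_q^{a \times b, r}$ denotes the set of $a\times b$ matrices over $\mathbb{F}_q$ of rank exactly $r$ (with $\mathbb{F}_q^{0\times b,0}$ the one-element set containing the empty matrix). $\mathbb{S}_m$ is the symmetric group on $\{1,\dots,m\}$; for $\pi\in\mathbb{S}_m$, $\bm{\pi}$ is the $m\times m$ permutation matrix whose $(i,j)$ entry is $\delta_{\pi(i),j}$. $\mathbb{S}_{m,k}$ is the set of permutations in $\mathbb{S}_m$ that are a product of exactly $k$ disjoint cycles (counting fixed points as cycles of length 1). For $(\bm{A},\bm{B},\bm{C})\in \mathbb{F}_q^{\ell\times m}\times\mathbb{F}_q^{m\times n}\times\mathbb{F}_q^{\ell\times n}$, $N_{\mathsf{sol}}(\bm{A},\bm{B},\bm{C})$ is the number of $\rho\in\mathbb{S}_m$ with $\bm{A}\bm{\rho}\bm{B}=\bm{C}$. Empty products equal $1$. *)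

theory Defs
  imports
    "HOL-Probability.Probability_Mass_Function"
    "HOL-Combinatorics.Cycles"
    "Jordan_Normal_Form.DL_Rank"
begin

text \<open>Rows, columns and permuted points are indexed from \<open>0\<close>, so the symmetric group on
  \<open>m\<close> letters is \<open>{p. p permutes {..<m}}\<close>. The field with \<open>q\<close> elements is a type of class
  \<open>{field, finite}\<close> with \<open>CARD('a) = q\<close>.\<close>

definition mats_of_rank :: "nat \<Rightarrow> nat \<Rightarrow> nat \<Rightarrow> 'a::field mat set" where
  "mats_of_rank a b r = {A \<in> carrier_mat a b. vec_space.rank a A = r}"

definition sym_group :: "nat \<Rightarrow> (nat \<Rightarrow> nat) set" where
  "sym_group m = {p. p permutes {..<m}}"

definition perm_mat :: "nat \<Rightarrow> (nat \<Rightarrow> nat) \<Rightarrow> 'a::{zero,one} mat" where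
  "perm_mat m p = Matrix.mat m m (\<lambda>(i, j). if p i = j then 1 else 0)"

text \<open>The cycles in the list are nonempty, pairwise disjoint and cover all points; fixed points
  occur as one-element cycles, for which \<^const>\<open>cycle_of_list\<close> is the identity.\<close>

definition sym_group_cycles :: "nat \<Rightarrow> nat \<Rightarrow> (nat \<Rightarrow> nat) set" where
  "sym_group_cycles m k =
    {p \<in> sym_group m. \<exists>css. length css = k \<and> [] \<notin> set css \<and> distinct (concat css) \<and>
       set (concat css) = {..<m} \<and> p = foldr (\<circ>) (map cycle_of_list css) id}"

definition N_sol :: "'a::field mat \<Rightarrow> 'a mat \<Rightarrow> 'a mat \<Rightarrow> nat" where
  "N_sol A B C = card {\<rho> \<in> sym_group (dim_col A). A * perm_mat (dim_col A) \<rho> * B = C}"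

definition GenIPKP ::
  "nat \<Rightarrow> nat \<Rightarrow> nat \<Rightarrow> ('a::{field,finite} mat \<times> 'a mat \<times> 'a mat \<times> (nat \<Rightarrow> nat)) pmf" where
  "GenIPKP l m n =
    do {
      A \<leftarrow> pmf_of_set (mats_of_rank l m l);
      B \<leftarrow> pmf_of_set (mats_of_rank m n n);
      p \<leftarrow> pmf_of_set (sym_group m);
      return_pmf (A, B, A * perm_mat m p * B, p)
    }"

end

theory Submission
  imports Defs "Jordan_Normal_Form.Matrix_Kernel"
begin

text \<open>Since a product of permutation matrices is a permutation matrix and \<open>A \<mapsto> A\<pi>\<close> permutes the
  matrices of full row rank, the expectation is the number of triples \<open>(\<sigma>, A, B)\<close> with
  \<open>A(\<sigma> - 1)B = 0\<close>, divided by the number of pairs \<open>(A, B)\<close>. If \<open>\<sigma>\<close> has \<open>k\<close> cycles, the kernel of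
  \<open>\<sigma> - 1\<close> consists of the vectors constant on cycles, so \<open>\<sigma> - 1\<close> has rank \<open>m - k\<close>. Up to an
  invertible change of coordinates, \<open>A(\<sigma> - 1)\<close> is then the block of the first \<open>m - k\<close> columns
  of \<open>A\<close>; fixing this block with rank \<open>r\<close> and row reducing it, the remaining \<open>k\<close> columns complete it
  to full row rank iff their last \<open>l - r\<close> rows have full rank, the first \<open>r\<close> rows being free. For each
  such \<open>A\<close>, the columns of \<open>B\<close> are independent vectors in a kernel of size \<open>q ^ (m - r)\<close>. Ranks
  are handled throughout via the cardinality of the range.\<close>

section \<open>Ranks and cardinalities\<close>

text \<open>The column space as a bare set, so that it can be counted and compared without fixing
  the dimension of a vector space locale.\<close>

definition mat_range :: "'a::semiring_0 mat \<Rightarrow> 'a vec set" where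
  "mat_range A = (\<lambda>v. A *\<^sub>v v) ` carrier_vec (dim_col A)"

lemma mat_range_subset: "A \<in> carrier_mat a b \<Longrightarrow> mat_range A \<subseteq> carrier_vec a"
  unfolding mat_range_def by auto

section \<open>Counting vectors and matrices with entries in a finite type\<close>

lemma card_carrier_vec: "card (carrier_vec n :: 'a::finite vec set) = CARD('a) ^ n"
proof -
  have "bij_betw (vec n) ({..<n} \<rightarrow>\<^sub>E (UNIV :: 'a set)) (carrier_vec n)"
  proof (rule bij_betw_byWitness[where f' = "\<lambda>v. restrict (\<lambda>i. v $ i) {..<n}"])
    show "\<forall>f\<in>{..<n} \<rightarrow>\<^sub>E (UNIV :: 'a set). restrict (\<lambda>i. vec n f $ i) {..<n} = f"
      by (intro ballI ext) (simp add: PiE_def extensional_def restrict_def)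
    show "\<forall>v\<in>carrier_vec n. vec n (restrict (\<lambda>i. v $ i) {..<n}) = (v :: 'a vec)"
      by (intro ballI eq_vecI) simp_all
    show "vec n ` ({..<n} \<rightarrow>\<^sub>E (UNIV :: 'a set)) \<subseteq> carrier_vec n" by (rule image_subsetI) simp
    show "(\<lambda>v. restrict (\<lambda>i. v $ i) {..<n}) ` carrier_vec n \<subseteq> {..<n} \<rightarrow>\<^sub>E (UNIV :: 'a set)"
      by (rule image_subsetI) simp
  qed
  then show ?thesis
    using bij_betw_same_card card_PiE[of "{..<n}" "\<lambda>_. UNIV :: 'a set"] by fastforce
qed

lemma card_carrier_mat: "card (carrier_mat a b :: 'a::finite mat set) = CARD('a) ^ (a * b)"
proof -
  let ?I = "{..<a} \<times> {..<b}"
  have "bij_betw (Matrix.mat a b) (?I \<rightarrow>\<^sub>E (UNIV :: 'a set)) (carrier_mat a b)"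
  proof (rule bij_betw_byWitness[where f' = "\<lambda>A. restrict (\<lambda>ij. A $$ ij) ?I"])
    show "\<forall>f\<in>?I \<rightarrow>\<^sub>E (UNIV :: 'a set). restrict (\<lambda>ij. Matrix.mat a b f $$ ij) ?I = f"
    proof
      fix f assume f: "f \<in> ?I \<rightarrow>\<^sub>E (UNIV :: 'a set)"
      have "restrict (\<lambda>ij. Matrix.mat a b f $$ ij) ?I = restrict f ?I" by (rule restrict_ext) auto
      then show "restrict (\<lambda>ij. Matrix.mat a b f $$ ij) ?I = f" using PiE_restrict[OF f] by simp
    qed
    show "\<forall>A\<in>carrier_mat a b. Matrix.mat a b (restrict (\<lambda>ij. A $$ ij) ?I) = (A :: 'a mat)"
      by (intro ballI eq_matI) simp_all
    show "Matrix.mat a b ` (?I \<rightarrow>\<^sub>E (UNIV :: 'a set)) \<subseteq> carrier_mat a b"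
      by (rule image_subsetI) simp
    show "(\<lambda>A. restrict (\<lambda>ij. A $$ ij) ?I) ` carrier_mat a b \<subseteq> ?I \<rightarrow>\<^sub>E (UNIV :: 'a set)"
      by (rule image_subsetI) simp
  qed
  then have "card (?I \<rightarrow>\<^sub>E (UNIV :: 'a set)) = card (carrier_mat a b :: 'a mat set)"
    by (rule bij_betw_same_card)
  then show ?thesis by (simp add: card_PiE)
qed

lemma finite_carrier_vec: "finite (carrier_vec n :: 'a::finite vec set)"
  by (rule card_ge_0_finite) (simp add: card_carrier_vec)

lemma finite_carrier_mat: "finite (carrier_mat a b :: 'a::finite mat set)"
  by (rule card_ge_0_finite) (simp add: card_carrier_mat)

lemma finite_mat_range: "finite (mat_range (A :: 'a::{semiring_0,finite} mat))"
  unfolding mat_range_def by (simp add: finite_carrier_vec)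

lemma card_ge_2: "CARD('a::{zero_neq_one,finite}) \<ge> 2"
proof -
  have "card {0, 1 :: 'a} \<le> CARD('a)" by (rule card_mono) auto
  then show ?thesis by simp
qed

lemma card_field_power_inject:
  "CARD('a::{zero_neq_one,finite}) ^ i = CARD('a) ^ j \<longleftrightarrow> i = j"
  using card_ge_2[where 'a='a] by (simp add: power_inject_exp)

section \<open>The rank read off from the size of the range\<close>

lemma (in vec_space) col_space_eq_mat_range:
  assumes "A \<in> carrier_mat n nc" shows "col_space A = mat_range A"
  using col_space_eq[OF assms] assms unfolding mat_range_def by auto

text \<open>A maximal independent set \<open>U\<close> of columns is a basis of the column space.
  Listing \<open>U\<close> as the columns of a matrix \<open>M\<close>, each vector of the range has
  a unique coefficient vector of length \<open>card U\<close>.\<close>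

lemma card_mat_range:
  fixes A :: "'a::{field,finite} mat"
  assumes A: "A \<in> carrier_mat a b"
  shows "card (mat_range A) = CARD('a) ^ vec_space.rank a A"
proof -
  interpret vec_space "TYPE('a)" a .
  have cols: "set (cols A) \<subseteq> carrier_vec a" using cols_dim A by blast
  obtain U where U: "finite U" "maximal U (\<lambda>T. T \<subseteq> set (cols A) \<and> lin_indpt T)"
    using maximal_exists_superset[of "set (cols A)" "\<lambda>T. T \<subseteq> set (cols A) \<and> lin_indpt T" "{}"]
    by (auto simp: finite_lin_indpt2)
  have r: "rank A = card U" using rank_card_indpt[OF A U(2)] .
  have UA: "U \<subseteq> set (cols A)" and li: "lin_indpt U" using U(2) unfolding maximal_def by auto
  obtain us where us: "set us = U" "distinct us" using finite_distinct_list U(1) by blast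
  define M where "M = mat_of_cols a us"
  have M: "M \<in> carrier_mat a (card U)"
    unfolding M_def using us by (metis distinct_card mat_of_cols_carrier(1))
  have colsM: "cols M = us" unfolding M_def using us UA cols by (intro cols_mat_of_cols) auto
  have U_carrier: "U \<subseteq> carrier_vec a" using UA cols by (rule subset_trans)
  \<comment> \<open>A column outside the span of \<open>U\<close> could be added to \<open>U\<close>
    without losing independence, against maximality.\<close>
  have "set (cols A) \<subseteq> span U"
  proof (rule subsetI, rule ccontr)
    fix s assume s: "s \<in> set (cols A)" "s \<notin> span U"
    have sc: "s \<in> carrier_vec a" using s(1) cols by (rule rev_subsetD)
    have sU: "s \<notin> U" using s(2) span_mem[OF U_carrier] by (rule contrapos_nn)
    have "lin_indpt (U \<union> {s})" using lin_dep_iff_in_span[OF U_carrier li sc sU] s(2) by simp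
    then have "U \<union> {s} = U" using U(2) s(1) UA unfolding maximal_def by blast
    then show False using sU by blast
  qed
  then have "span (set (cols A)) = span U"
    by (rule subset_antisym[OF span_subsetI[OF U_carrier] span_is_monotone[OF UA]])
  then have "mat_range A = mat_range M"
    using col_space_eq_mat_range[OF A] col_space_eq_mat_range[OF M] us colsM
    unfolding col_space_def by simp
  moreover have "inj_on (\<lambda>v. M *\<^sub>v v) (carrier_vec (card U))"
  proof (rule inj_onI)
    fix v w assume v: "v \<in> carrier_vec (card U)" and w: "w \<in> carrier_vec (card U)"
      and eq: "M *\<^sub>v v = M *\<^sub>v w"
    \<comment> \<open>A nonzero difference in the kernel would be a linear relation between the
      independent columns of \<open>M\<close>.\<close>
    have "M *\<^sub>v (v - w) = 0\<^sub>v a" using M v w eq by (simp add: mult_minus_distrib_mat_vec)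
    then have "v - w = 0\<^sub>v (card U)" using lin_depI[OF M, of "v - w"] colsM us li v w by auto
    moreover have "v = (v - w) + w" using v w by (intro eq_vecI) auto
    ultimately show "v = w" using w by simp
  qed
  then have "card (mat_range M) = CARD('a) ^ card U"
    unfolding mat_range_def using M by (simp add: card_image card_carrier_vec)
  ultimately show ?thesis using r by simp
qed

text \<open>Since the field has at least two elements, the exponent is determined by the power; from
  here on ranks can be replaced by cardinalities.\<close>

lemma mats_of_rank_eq_card_range:
  "(mats_of_rank a b r :: 'a::{field,finite} mat set) =
     {A \<in> carrier_mat a b. card (mat_range A) = CARD('a) ^ r}"
  unfolding mats_of_rank_def by (auto simp: card_mat_range card_field_power_inject)

text \<open>A subset of the finite set \<open>carrier_vec a\<close> with as many elements must be
  all of it.\<close>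

lemma mats_of_full_row_rank_iff:
  fixes A :: "'a::{field,finite} mat"
  shows "A \<in> mats_of_rank a b a \<longleftrightarrow> A \<in> carrier_mat a b \<and> mat_range A = carrier_vec a"
proof -
  have "card (mat_range A) = CARD('a) ^ a \<longleftrightarrow> mat_range A = carrier_vec a"
    if "A \<in> carrier_mat a b"
    using card_subset_eq[OF finite_carrier_vec mat_range_subset[OF that]]
    by (auto simp: card_carrier_vec)
  then show ?thesis by (auto simp: mats_of_rank_eq_card_range)
qed

text \<open>On a finite domain a map is injective exactly if its image is as large as the
  domain.\<close>

lemma mats_of_full_col_rank_iff:
  fixes A :: "'a::{field,finite} mat"
  shows "A \<in> mats_of_rank a b b \<longleftrightarrow> A \<in> carrier_mat a b \<and> inj_on (\<lambda>v. A *\<^sub>v v) (carrier_vec b)"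
proof -
  have "card (mat_range A) = CARD('a) ^ b \<longleftrightarrow> inj_on (\<lambda>v. A *\<^sub>v v) (carrier_vec b)"
    if "A \<in> carrier_mat a b"
    using inj_on_iff_eq_card[OF finite_carrier_vec[of b], of "\<lambda>v. A *\<^sub>v v"] that
    by (auto simp: card_carrier_vec mat_range_def)
  then show ?thesis by (auto simp: mats_of_rank_eq_card_range)
qed

lemma finite_mat_kernel: "finite (mat_kernel (A :: 'a::{comm_ring_1,finite} mat))"
  by (rule finite_subset[OF _ finite_carrier_vec[of "dim_col A"]]) (auto simp: mat_kernel_def)

text \<open>Rank-nullity in counting form: the domain is partitioned into fibres, and the fibre over
  \<open>A *\<^sub>v x\<close> is the kernel translated by \<open>x\<close>.\<close>

lemma card_mat_range_times_card_mat_kernel: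
  fixes A :: "'a::{field,finite} mat"
  assumes A: "A \<in> carrier_mat a b"
  shows "card (mat_range A) * card (mat_kernel A) = CARD('a) ^ b"
proof -
  have fiber: "card {v \<in> carrier_vec b. A *\<^sub>v v = y} = card (mat_kernel A)"
    if "y \<in> mat_range A" for y
  proof -
    obtain x where x: "x \<in> carrier_vec b" "y = A *\<^sub>v x"
      using \<open>y \<in> mat_range A\<close> A unfolding mat_range_def by auto
    have cancel: "v + x - x = v" "v - x + x = v" if "v \<in> carrier_vec b" for v
      using that x(1) by (auto intro!: eq_vecI)
    have "bij_betw (\<lambda>v. v + x) (mat_kernel A) {v \<in> carrier_vec b. A *\<^sub>v v = y}"
      by (rule bij_betw_byWitness[where f' = "\<lambda>v. v - x"])
        (use A x in \<open>auto simp: mat_kernel[OF A] cancel mult_add_distrib_mat_vec[OF A]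
          mult_minus_distrib_mat_vec[OF A]\<close>)
    then show ?thesis by (rule bij_betw_same_card[symmetric])
  qed
  have "CARD('a) ^ b = card (\<Union>y\<in>mat_range A. {v \<in> carrier_vec b. A *\<^sub>v v = y})"
    using A by (auto simp: card_carrier_vec[symmetric] mat_range_def intro!: arg_cong[of _ _ card])
  also have "\<dots> = (\<Sum>y\<in>mat_range A. card {v \<in> carrier_vec b. A *\<^sub>v v = y})"
    by (rule card_UN_disjoint) (auto simp: finite_mat_range finite_carrier_vec)
  also have "\<dots> = card (mat_range A) * card (mat_kernel A)" by (simp add: fiber)
  finally show ?thesis by simp
qed

lemma card_mat_kernel:
  fixes A :: "'a::{field,finite} mat"
  assumes A: "A \<in> carrier_mat a b" and r: "card (mat_range A) = CARD('a) ^ r"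
  shows "r \<le> b" "card (mat_kernel A) = CARD('a) ^ (b - r)"
proof -
  have eq: "CARD('a) ^ r * card (mat_kernel A) = CARD('a) ^ b"
    using card_mat_range_times_card_mat_kernel[OF A] r by simp
  \<comment> \<open>A divisor of a positive number does not exceed it. The bound on \<open>r\<close>
    makes the natural subtraction \<open>b - r\<close> a true difference.\<close>
  have "CARD('a) ^ r \<le> CARD('a) ^ b"
    using eq by (metis dvd_triv_left dvd_imp_le zero_less_card_finite zero_less_power)
  then show "r \<le> b" using card_ge_2[where 'a='a] power_le_imp_le_exp[of "CARD('a)" r b] by simp
  then have "CARD('a) ^ r * CARD('a) ^ (b - r) = CARD('a) ^ b" by (simp add: power_add[symmetric])
  then have "CARD('a) ^ r * card (mat_kernel A) = CARD('a) ^ r * CARD('a) ^ (b - r)"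
    using eq by simp
  then show "card (mat_kernel A) = CARD('a) ^ (b - r)" by simp
qed

text \<open>Gauss-Jordan elimination puts the nonzero rows on top. They form \<open>R\<close>, and
  its pivot columns form an identity matrix, which supplies the right inverse.\<close>

lemma exists_row_reduction:
  fixes A :: "'a::field mat"
  assumes A: "A \<in> carrier_mat a b"
  obtains P Q d R S where "P \<in> carrier_mat a a" "Q \<in> carrier_mat a a" "P * Q = 1\<^sub>m a" "Q * P = 1\<^sub>m a"
    "d \<le> a" "R \<in> carrier_mat d b" "S \<in> carrier_mat b d" "R * S = 1\<^sub>m d"
    "P * A = R @\<^sub>r 0\<^sub>m (a - d) b"
proof -
  define C where "C = gauss_jordan_single A"
  note gj = gauss_jordan_single[OF A C_def[symmetric]]
  obtain P Q where PQ: "C = P * A" "P \<in> carrier_mat a a" "Q \<in> carrier_mat a a"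
    "P * Q = 1\<^sub>m a" "Q * P = 1\<^sub>m a" using gj(4) by blast
  have C: "C \<in> carrier_mat a b" by (rule gj(2))
  obtain p where p: "pivot_fun C p b" using gj(3) C unfolding row_echelon_form_def by auto
  have dC: "dim_row C = a" using C by simp
  note piv = pivot_funD[OF dC p]
  \<comment> \<open>The value \<open>p i = b\<close> marks a zero row, so \<open>d\<close> counts
    the nonzero rows.\<close>
  define d where "d = card {i. i < a \<and> p i < b}"
  \<comment> \<open>Pivots strictly increase until they reach \<open>b\<close>, so every row above a
    nonzero row is nonzero.\<close>
  have down: "p i < b" if "i \<le> j" "j < a" "p j < b" for i j
    using that
  proof (induction j rule: dec_induct)
    case (step j)
    then show ?case using piv(3)[of j] by auto
  qed simp
  have da: "d \<le> a" unfolding d_def using card_mono[of "{..<a}" "{i. i < a \<and> p i < b}"] by auto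
  have initial: "{i. i < a \<and> p i < b} = {..<d}"
  proof -
    let ?J = "{i. i < a \<and> p i < b}"
    have "i < d" if "i \<in> ?J" for i
    proof -
      \<comment> \<open>By downward closure the \<open>i + 1\<close> rows up to \<open>i\<close> are
        all counted by \<open>d\<close>.\<close>
      have "{..i} \<subseteq> ?J" using that down by fastforce
      then have "card {..i} \<le> d" unfolding d_def by (intro card_mono) auto
      then show ?thesis by simp
    qed
    then have "?J \<subseteq> {..<d}" by auto
    then show ?thesis by (intro card_subset_eq) (auto simp: d_def)
  qed
  then have pd: "p i < b \<longleftrightarrow> i < d" if "i < a" for i using that by (auto simp: set_eq_iff)
  define R where "R = Matrix.mat d b (\<lambda>ij. C $$ ij)"
  \<comment> \<open>Column \<open>i\<close> of \<open>S\<close> is the unit vector at the pivot of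
    row \<open>i\<close>, so multiplying by \<open>S\<close> selects the pivot columns of
    \<open>R\<close>.\<close>
  define S where "S = Matrix.mat b d (\<lambda>(j, i). if j = p i then 1 else 0 :: 'a)"
  have R: "R \<in> carrier_mat d b" and S: "S \<in> carrier_mat b d" unfolding R_def S_def by auto
  have "R * S = 1\<^sub>m d"
  proof (rule eq_matI)
    fix i j assume "i < dim_row (1\<^sub>m d :: 'a mat)" "j < dim_col (1\<^sub>m d :: 'a mat)"
    then have ij: "i < d" "j < d" by auto
    then have pj: "p j < b" and ia: "i < a" and ja: "j < a" using pd da by auto
    have "(R * S) $$ (i, j) = (\<Sum>k<b. C $$ (i, k) * (if k = p j then 1 else 0))"
      using ij by (simp add: R_def S_def scalar_prod_def lessThan_atLeast0)
    also have "\<dots> = C $$ (i, p j)" using pj by (simp add: if_distrib sum.delta cong: if_cong)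
    also have "\<dots> = 1\<^sub>m d $$ (i, j)" using piv(4)[OF ja pj] piv(5)[OF ja pj ia] ij by auto
    finally show "(R * S) $$ (i, j) = 1\<^sub>m d $$ (i, j)" .
  qed (auto simp: R_def S_def)
  moreover have "P * A = R @\<^sub>r 0\<^sub>m (a - d) b"
    unfolding PQ(1)[symmetric]
  proof (rule eq_matI)
    fix i j assume "i < dim_row (R @\<^sub>r 0\<^sub>m (a - d) b)" "j < dim_col (R @\<^sub>r 0\<^sub>m (a - d) b)"
    then have ij: "i < a" "j < b" using R da by (auto simp: append_rows_def)
    \<comment> \<open>Below row \<open>d\<close> the pivot index is \<open>b\<close>, and all
      entries left of it vanish.\<close>
    show "C $$ (i, j) = (R @\<^sub>r 0\<^sub>m (a - d) b) $$ (i, j)"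
      using ij da pd[of i] piv(1)[of i] piv(2)[of i j] unfolding append_rows_def R_def by auto
  qed (use C R da in \<open>auto simp: append_rows_def\<close>)
  ultimately show thesis using that PQ da R S by blast
qed

section \<open>Block matrices\<close>

lemma mult_mat_vec_in_mat_range:
  "A \<in> carrier_mat a b \<Longrightarrow> v \<in> carrier_vec b \<Longrightarrow> A *\<^sub>v v \<in> mat_range A"
  unfolding mat_range_def by auto

text \<open>The arguments reaching \<open>X\<close> through a surjective \<open>R\<close> are all
  vectors, so such a factor on the right does not change the rank.\<close>

lemma mat_range_mult_surj:
  fixes X :: "'a::comm_ring_1 mat"
  assumes X: "X \<in> carrier_mat l d" and R: "R \<in> carrier_mat d b"
    and surj: "mat_range R = carrier_vec d"
  shows "mat_range (X * R) = mat_range X"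
proof -
  have "mat_range (X * R) = (\<lambda>v. X *\<^sub>v (R *\<^sub>v v)) ` carrier_vec b"
    unfolding mat_range_def using X R by (intro image_cong) auto
  also have "\<dots> = (\<lambda>v. X *\<^sub>v v) ` mat_range R"
    unfolding mat_range_def using R by (simp add: image_image)
  also have "\<dots> = mat_range X" unfolding surj unfolding mat_range_def using X by simp
  finally show ?thesis .
qed

lemma mat_range_right_inverse:
  fixes R :: "'a::comm_ring_1 mat"
  assumes R: "R \<in> carrier_mat d b" and S: "S \<in> carrier_mat b d" and RS: "R * S = 1\<^sub>m d"
  shows "mat_range R = carrier_vec d"
proof
  show "carrier_vec d \<subseteq> mat_range R"
  proof
    fix w :: "'a vec" assume w: "w \<in> carrier_vec d"
    have "R *\<^sub>v (S *\<^sub>v w) = (R * S) *\<^sub>v w" by (rule assoc_mult_mat_vec[symmetric]) (use R S w in auto)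
    then have "w = R *\<^sub>v (S *\<^sub>v w)" using w RS by simp
    then show "w \<in> mat_range R" using mult_mat_vec_in_mat_range[OF R, of "S *\<^sub>v w"] S w by simp
  qed
qed (rule mat_range_subset[OF R])

text \<open>The empty lower blocks make the library lemmas on \<^const>\<open>four_block_mat\<close> applicable.\<close>

definition append_cols :: "'a::zero mat \<Rightarrow> 'a mat \<Rightarrow> 'a mat" where
  "append_cols X Y = four_block_mat X Y (0\<^sub>m 0 (dim_col X)) (0\<^sub>m 0 (dim_col Y))"

lemma append_cols_carrier [simp, intro]:
  "X \<in> carrier_mat l d \<Longrightarrow> Y \<in> carrier_mat l k \<Longrightarrow> append_cols X Y \<in> carrier_mat l (d + k)"
  unfolding append_cols_def by auto

lemma append_cols_mult_vec:
  fixes X :: "'a::comm_ring_1 mat"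
  assumes "X \<in> carrier_mat l d" "Y \<in> carrier_mat l k" "x \<in> carrier_vec d" "y \<in> carrier_vec k"
  shows "append_cols X Y *\<^sub>v (x @\<^sub>v y) = X *\<^sub>v x + Y *\<^sub>v y"
proof -
  have "append_cols X Y *\<^sub>v (x @\<^sub>v y) =
      (X *\<^sub>v x + Y *\<^sub>v y) @\<^sub>v (0\<^sub>m 0 d *\<^sub>v x + 0\<^sub>m 0 k *\<^sub>v y)"
    unfolding append_cols_def using assms
    by (subst four_block_mat_mult_vec[of _ l d _ k _ 0]) auto
  \<comment> \<open>The lower block has length 0, so appending it changes nothing.\<close>
  also have "\<dots> = X *\<^sub>v x + Y *\<^sub>v y" using assms by (intro eq_vecI) auto
  finally show ?thesis .
qed

lemma append_cols_mult_append_rows: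
  fixes X :: "'a::comm_ring_1 mat"
  assumes "X \<in> carrier_mat l d" "Y \<in> carrier_mat l k" "R \<in> carrier_mat d b" "T \<in> carrier_mat k b"
  shows "append_cols X Y * (R @\<^sub>r T) = X * R + Y * T"
proof -
  have "append_cols X Y * (R @\<^sub>r T) = four_block_mat (X * R + Y * T) (X * 0\<^sub>m d 0 + Y * 0\<^sub>m k 0)
     (0\<^sub>m 0 d * R + 0\<^sub>m 0 k * T) (0\<^sub>m 0 d * 0\<^sub>m d 0 + 0\<^sub>m 0 k * 0\<^sub>m k 0)"
    unfolding append_cols_def append_rows_def using assms
    by (subst mult_four_block_mat[of _ l d _ k _ 0 _ _ b _ 0]) auto
  also have "\<dots> = X * R + Y * T" using assms by (intro eq_matI) auto
  finally show ?thesis .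
qed

lemma mult_append_cols:
  fixes M :: "'a::comm_ring_1 mat"
  assumes "M \<in> carrier_mat a l" "X \<in> carrier_mat l d" "Y \<in> carrier_mat l k"
  shows "M * append_cols X Y = append_cols (M * X) (M * Y)"
proof (rule eq_matI)
  fix i j assume "i < dim_row (append_cols (M * X) (M * Y))" "j < dim_col (append_cols (M * X) (M * Y))"
  then have ij: "i < a" "j < d + k" using assms by (auto simp: append_cols_def)
  have "col (append_cols X Y) j = (if j < d then col X j else col Y (j - d))"
    using assms ij by (intro eq_vecI) (auto simp: append_cols_def)
  then show "(M * append_cols X Y) $$ (i, j) = append_cols (M * X) (M * Y) $$ (i, j)"
    using assms ij by (auto simp: append_cols_def)
qed (use assms in \<open>auto simp: append_cols_def\<close>)

lemma append_vec_cases: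
  assumes "v \<in> carrier_vec (d + k)"
  obtains x y where "v = x @\<^sub>v y" "x \<in> carrier_vec d" "y \<in> carrier_vec k"
  using assms vec_first_last_append[of v d k] vec_first_carrier vec_last_carrier by metis

lemma mat_range_append_cols:
  fixes X :: "'a::comm_ring_1 mat"
  assumes X: "X \<in> carrier_mat l d" and Y: "Y \<in> carrier_mat l k"
  shows "mat_range (append_cols X Y) =
    {X *\<^sub>v x + Y *\<^sub>v y | x y. x \<in> carrier_vec d \<and> y \<in> carrier_vec k}" (is "_ = ?R")
proof (intro equalityI subsetI)
  fix w assume "w \<in> mat_range (append_cols X Y)"
  then obtain v where v: "v \<in> carrier_vec (d + k)" "w = append_cols X Y *\<^sub>v v"
    unfolding mat_range_def using append_cols_carrier[OF X Y] by auto
  obtain x y where "v = x @\<^sub>v y" "x \<in> carrier_vec d" "y \<in> carrier_vec k"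
    using v(1) by (rule append_vec_cases)
  then show "w \<in> ?R" using v(2) append_cols_mult_vec[OF X Y] by auto
next
  fix w assume "w \<in> ?R"
  then obtain x y where "w = X *\<^sub>v x + Y *\<^sub>v y" "x \<in> carrier_vec d" "y \<in> carrier_vec k" by blast
  then show "w \<in> mat_range (append_cols X Y)"
    using mult_mat_vec_in_mat_range[OF append_cols_carrier[OF X Y], of "x @\<^sub>v y"]
    by (simp add: append_cols_mult_vec[OF X Y])
qed

section \<open>Splitting matrices into blocks and changing coordinates by invertible
  matrices\<close>

lemma bij_betw_append_cols:
  "bij_betw (\<lambda>(X, Y). append_cols X Y) (carrier_mat l d \<times> carrier_mat l k) (carrier_mat l (d + k))"
proof (rule bij_betw_byWitness[where f' = "\<lambda>A. (Matrix.mat l d (\<lambda>ij. A $$ ij),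
    Matrix.mat l k (\<lambda>(i, j). A $$ (i, j + d)))"])
  show "\<forall>p\<in>carrier_mat l d \<times> carrier_mat l k.
    (Matrix.mat l d (\<lambda>ij. (case p of (X, Y) \<Rightarrow> append_cols X Y) $$ ij),
     Matrix.mat l k (\<lambda>(i, j). (case p of (X, Y) \<Rightarrow> append_cols X Y) $$ (i, j + d))) = p"
    by (auto simp: append_cols_def intro!: eq_matI)
qed (auto simp: append_cols_def intro!: eq_matI)

lemma bij_betw_append_rows:
  "bij_betw (\<lambda>(X, Y). X @\<^sub>r Y) (carrier_mat d k \<times> carrier_mat e k) (carrier_mat (d + e) k)"
proof (rule bij_betw_byWitness[where f' = "\<lambda>A. (Matrix.mat d k (\<lambda>ij. A $$ ij),
    Matrix.mat e k (\<lambda>(i, j). A $$ (i + d, j)))"])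
  show "\<forall>p\<in>carrier_mat d k \<times> carrier_mat e k.
    (Matrix.mat d k (\<lambda>ij. (case p of (X, Y) \<Rightarrow> X @\<^sub>r Y) $$ ij),
     Matrix.mat e k (\<lambda>(i, j). (case p of (X, Y) \<Rightarrow> X @\<^sub>r Y) $$ (i + d, j))) = p"
    by (auto simp: append_rows_def intro!: eq_matI)
qed (auto simp: append_rows_def intro!: eq_matI)

lemma bij_betw_mult_left:
  fixes P :: "'a::comm_ring_1 mat"
  assumes "P \<in> carrier_mat a a" "Q \<in> carrier_mat a a" "P * Q = 1\<^sub>m a" "Q * P = 1\<^sub>m a"
  shows "bij_betw (\<lambda>Y. P * Y) (carrier_mat a b) (carrier_mat a b)"
  using assms
  by (intro bij_betw_byWitness[where f' = "\<lambda>Y. Q * Y"])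
    (auto simp: assoc_mult_mat[symmetric, where n\<^sub>2 = a])

lemma bij_betw_mult_right:
  fixes P :: "'a::comm_ring_1 mat"
  assumes "P \<in> carrier_mat a a" "Q \<in> carrier_mat a a" "P * Q = 1\<^sub>m a" "Q * P = 1\<^sub>m a"
  shows "bij_betw (\<lambda>Y. Y * P) (carrier_mat b a) (carrier_mat b a)"
  using assms
  by (intro bij_betw_byWitness[where f' = "\<lambda>Y. Y * Q"]) auto

lemma inj_on_mult_mat_vec_iff:
  fixes A :: "'a::comm_ring_1 mat"
  assumes A: "A \<in> carrier_mat a b"
  shows "inj_on (\<lambda>v. A *\<^sub>v v) (carrier_vec b) \<longleftrightarrow> mat_kernel A \<subseteq> {0\<^sub>v b}"
proof
  assume inj: "inj_on (\<lambda>v. A *\<^sub>v v) (carrier_vec b)"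
  show "mat_kernel A \<subseteq> {0\<^sub>v b}"
  proof
    fix v assume "v \<in> mat_kernel A"
    then have "v \<in> carrier_vec b" "A *\<^sub>v v = A *\<^sub>v 0\<^sub>v b" using A by (auto simp: mat_kernel[OF A])
    then show "v \<in> {0\<^sub>v b}" using inj by (auto dest: inj_onD)
  qed
next
  assume ker: "mat_kernel A \<subseteq> {0\<^sub>v b}"
  show "inj_on (\<lambda>v. A *\<^sub>v v) (carrier_vec b)"
  proof (rule inj_onI)
    fix v w assume v: "v \<in> carrier_vec b" and w: "w \<in> carrier_vec b" and "A *\<^sub>v v = A *\<^sub>v w"
    then have "v - w \<in> mat_kernel A" using A by (auto simp: mat_kernel[OF A] mult_minus_distrib_mat_vec)
    then have "v - w = 0\<^sub>v b" using ker by blast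
    moreover have "v = (v - w) + w" using v w by (intro eq_vecI) auto
    ultimately show "v = w" using w by simp
  qed
qed

section \<open>Matrices of full column rank with columns in a kernel\<close>

lemma mult_mat_vec_single_col:
  fixes Y :: "'a::comm_ring_1 mat"
  assumes "Y \<in> carrier_mat m 1" "y \<in> carrier_vec 1"
  shows "Y *\<^sub>v y = y $ 0 \<cdot>\<^sub>v col Y 0"
  using assms by (intro eq_vecI) (auto simp: scalar_prod_def mult.commute)

lemma vec_1_cases:
  fixes y :: "'a vec"
  assumes "y \<in> carrier_vec 1"
  obtains c where "y = vec 1 (\<lambda>_. c)"
proof
  show "y = vec 1 (\<lambda>_. y $ 0)" using assms by (intro eq_vecI) auto
qed

text \<open>A linear relation between the columns of \<open>B\<close> and \<open>v\<close> either
  has coefficient 0 at \<open>v\<close>, and is then a relation for \<open>B\<close> alone, or can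
  be solved for \<open>v\<close>.\<close>

lemma inj_on_append_single_col_iff:
  fixes B :: "'a::field mat"
  assumes B: "B \<in> carrier_mat m n" and v: "v \<in> carrier_vec m"
  shows "inj_on (\<lambda>w. append_cols B (mat_of_cols m [v]) *\<^sub>v w) (carrier_vec (n + 1)) \<longleftrightarrow>
    inj_on (\<lambda>w. B *\<^sub>v w) (carrier_vec n) \<and> v \<notin> mat_range B"
proof -
  let ?V = "mat_of_cols m [v]" and ?A = "append_cols B (mat_of_cols m [v])"
  have V: "?V \<in> carrier_mat m 1" using mat_of_cols_carrier(1)[of m "[v]"] by simp
  have A: "?A \<in> carrier_mat m (n + 1)" using B V by (rule append_cols_carrier)
  have col: "col ?V 0 = v" using v by (intro eq_vecI) (auto simp: mat_of_cols_def)
  have mult: "?A *\<^sub>v (x @\<^sub>v vec 1 (\<lambda>_. c)) = B *\<^sub>v x + c \<cdot>\<^sub>v v" if "x \<in> carrier_vec n" for x c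
    by (subst append_cols_mult_vec[OF B V that]) (auto simp: mult_mat_vec_single_col[OF V] col)
  show ?thesis
    unfolding inj_on_mult_mat_vec_iff[OF A] inj_on_mult_mat_vec_iff[OF B]
  proof (intro iffI conjI)
    assume ker: "mat_kernel ?A \<subseteq> {0\<^sub>v (n + 1)}"
    \<comment> \<open>Vectors of length \<open>n + 1\<close> are treated as pairs of a vector
      \<open>x\<close> and a last coefficient \<open>c\<close>.\<close>
    have zero: "x = 0\<^sub>v n \<and> c = 0" if "x \<in> carrier_vec n" "B *\<^sub>v x + c \<cdot>\<^sub>v v = 0\<^sub>v m" for x c
    proof -
      have "x @\<^sub>v vec 1 (\<lambda>_. c) \<in> mat_kernel ?A"
        unfolding mat_kernel[OF A]
        using that(2) mult[OF that(1), of c] append_carrier_vec[OF that(1), of "vec 1 (\<lambda>_. c)" 1]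
        by (simp del: One_nat_def)
      then have eq: "x @\<^sub>v vec 1 (\<lambda>_. c) = 0\<^sub>v (n + 1)" using ker by blast
      have "x $ i = 0" if "i < n" for i
        using arg_cong[OF eq, of "\<lambda>w. w $ i"] that \<open>x \<in> carrier_vec n\<close> by simp
      moreover have "c = 0" using arg_cong[OF eq, of "\<lambda>w. w $ n"] \<open>x \<in> carrier_vec n\<close> by simp
      ultimately show ?thesis using \<open>x \<in> carrier_vec n\<close> by (auto intro!: eq_vecI)
    qed
    show "mat_kernel B \<subseteq> {0\<^sub>v n}"
    proof
      fix x assume "x \<in> mat_kernel B"
      then have "x \<in> carrier_vec n" "B *\<^sub>v x + 0 \<cdot>\<^sub>v v = 0\<^sub>v m"
        using v B by (auto simp: mat_kernel[OF B] intro!: eq_vecI)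
      then show "x \<in> {0\<^sub>v n}" using zero by blast
    qed
    show "v \<notin> mat_range B"
    proof
      assume "v \<in> mat_range B"
      then obtain x where x: "x \<in> carrier_vec n" "v = B *\<^sub>v x" using B unfolding mat_range_def by auto
      \<comment> \<open>Writing \<open>v\<close> as a value of \<open>B\<close> gives a relation
        with coefficient -1 at \<open>v\<close>, which is nonzero in a field.\<close>
      have "B *\<^sub>v x + (- 1) \<cdot>\<^sub>v v = 0\<^sub>v m" using x(2)[symmetric] v by (intro eq_vecI) auto
      then have "- 1 = (0 :: 'a)" using zero[OF x(1)] by blast
      then show False by simp
    qed
  next
    assume asm: "mat_kernel B \<subseteq> {0\<^sub>v n} \<and> v \<notin> mat_range B"
    show "mat_kernel ?A \<subseteq> {0\<^sub>v (n + 1)}"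
    proof
      fix w assume "w \<in> mat_kernel ?A"
      then have w: "w \<in> carrier_vec (n + 1)" "?A *\<^sub>v w = 0\<^sub>v m" by (auto simp: mat_kernel[OF A])
      obtain x y where xy: "w = x @\<^sub>v y" "x \<in> carrier_vec n" "y \<in> carrier_vec 1"
        using w(1) by (rule append_vec_cases)
      obtain c where c: "y = vec 1 (\<lambda>_. c)" using xy(3) by (rule vec_1_cases)
      have eq: "B *\<^sub>v x + c \<cdot>\<^sub>v v = 0\<^sub>v m" using mult[OF xy(2), of c] w(2) xy(1) c by simp
      have "c = 0"
      proof (rule ccontr)
        assume "c \<noteq> 0"
        \<comment> \<open>Dividing the relation by \<open>- c\<close> exhibits \<open>v\<close> as a
          value of \<open>B\<close>.\<close>
        have "B *\<^sub>v ((- inverse c) \<cdot>\<^sub>v x) = (- inverse c) \<cdot>\<^sub>v (B *\<^sub>v x)"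
          using B xy(2) by (rule mult_mat_vec)
        also have "\<dots> = v"
        proof (rule eq_vecI)
          fix i assume "i < dim_vec v"
          then have i: "i < m" using v by simp
          have "(B *\<^sub>v x) $ i + c * v $ i = 0" using arg_cong[OF eq, of "\<lambda>w. w $ i"] i v B by simp
          then have "(B *\<^sub>v x) $ i = - (c * v $ i)" by (simp add: eq_neg_iff_add_eq_0)
          then show "((- inverse c) \<cdot>\<^sub>v (B *\<^sub>v x)) $ i = v $ i" using i B \<open>c \<noteq> 0\<close> by simp
        qed (use B v in auto)
        finally have "v = B *\<^sub>v ((- inverse c) \<cdot>\<^sub>v x)" by simp
        then have "v \<in> mat_range B"
          using mult_mat_vec_in_mat_range[OF B, of "(- inverse c) \<cdot>\<^sub>v x"] xy(2) by simp
        then show False using asm by blast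
      qed
      moreover have "B *\<^sub>v x + 0 \<cdot>\<^sub>v v = B *\<^sub>v x" using v B by (intro eq_vecI) auto
      ultimately have "B *\<^sub>v x = 0\<^sub>v m" using eq by simp
      then have "x = 0\<^sub>v n" using asm xy(2) by (auto simp: mat_kernel[OF B])
      then have "w = 0\<^sub>v (n + 1)" unfolding xy(1) c \<open>c = 0\<close> by (intro eq_vecI) auto
      then show "w \<in> {0\<^sub>v (n + 1)}" by simp
    qed
  qed
qed

lemma mult_append_single_col_eq_0_iff:
  fixes M :: "'a::comm_ring_1 mat"
  assumes M: "M \<in> carrier_mat l m" and B: "B \<in> carrier_mat m n" and v: "v \<in> carrier_vec m"
  shows "M * append_cols B (mat_of_cols m [v]) = 0\<^sub>m l (n + 1) \<longleftrightarrow>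
    M * B = 0\<^sub>m l n \<and> v \<in> mat_kernel M"
proof -
  let ?V = "mat_of_cols m [v]"
  have V: "?V \<in> carrier_mat m 1" using mat_of_cols_carrier(1)[of m "[v]"] by simp
  \<comment> \<open>Appending columns is injective on blocks of fixed size, so the product vanishes
    exactly if both blocks do.\<close>
  have "append_cols (M * B) (M * ?V) = append_cols (0\<^sub>m l n) (0\<^sub>m l 1) \<longleftrightarrow>
      M * B = 0\<^sub>m l n \<and> M * ?V = 0\<^sub>m l 1"
    using bij_betw_imp_inj_on[OF bij_betw_append_cols[of l n 1]] M B V
    by (auto dest: inj_onD[of _ _ "(M * B, M * ?V)" "(0\<^sub>m l n, 0\<^sub>m l 1)"])
  moreover have "append_cols (0\<^sub>m l n) (0\<^sub>m l 1) = (0\<^sub>m l (n + 1) :: 'a mat)"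
    by (intro eq_matI) (auto simp: append_cols_def)
  moreover have "M * ?V = 0\<^sub>m l 1 \<longleftrightarrow> v \<in> mat_kernel M"
  proof -
    have col: "col ?V 0 = v" using v by (intro eq_vecI) (auto simp: mat_of_cols_def)
    have "col (M * ?V) 0 = M *\<^sub>v v" using col_mult2[OF M V, of 0] col by simp
    moreover have "M * ?V = 0\<^sub>m l 1 \<longleftrightarrow> col (M * ?V) 0 = 0\<^sub>v l"
    proof
      assume c: "col (M * ?V) 0 = 0\<^sub>v l"
      show "M * ?V = 0\<^sub>m l 1"
      proof (rule eq_matI)
        fix i j assume "i < dim_row (0\<^sub>m l 1 :: 'a mat)" "j < dim_col (0\<^sub>m l 1 :: 'a mat)"
        then show "(M * ?V) $$ (i, j) = 0\<^sub>m l 1 $$ (i, j)"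
          using arg_cong[OF c, of "\<lambda>w. w $ i"] M V by (simp add: col_def)
      qed (use M V in auto)
    qed simp
    ultimately show ?thesis using v by (simp add: mat_kernel[OF M])
  qed
  ultimately show ?thesis using mult_append_cols[OF M B V] by metis
qed

text \<open>Build \<open>B\<close> column by column. All columns lie in the kernel of
  \<open>M\<close>, and after \<open>n\<close> independent ones the next may be any kernel vector
  outside their span, a subspace of the kernel with \<open>CARD('a) ^ n\<close> elements. If the
  kernel is too small, one factor is 0.\<close>

lemma card_full_col_rank_annihilated:
  fixes M :: "'a::{field,finite} mat"
  assumes M: "M \<in> carrier_mat l m"
  shows "real (card {B \<in> mats_of_rank m n n. M * B = 0\<^sub>m l n}) =
    (\<Prod>i = 0..<n. real (card (mat_kernel M)) - real CARD('a) ^ i)"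
proof (induction n)
  case 0
  \<comment> \<open>Base case: there is only one vector of length 0, so every matrix without columns
    acts injectively, and there is one such matrix.\<close>
  have "inj_on (\<lambda>w. B *\<^sub>v w) (carrier_vec 0)" for B :: "'a mat"
    by (rule inj_onI) (auto intro: eq_vecI)
  then have "{B \<in> mats_of_rank m 0 0. M * B = 0\<^sub>m l 0} = {0\<^sub>m m 0}"
    using M by (auto simp: mats_of_full_col_rank_iff intro!: eq_matI)
  then show ?case by simp
next
  case (Suc n)
  let ?I = "\<lambda>n. {B \<in> mats_of_rank m n n. M * B = 0\<^sub>m l n}"
  let ?f = "\<lambda>(B, v). append_cols B (mat_of_cols m [v])"
  have V: "mat_of_cols m [v] \<in> carrier_mat m 1" for v :: "'a vec"
    using mat_of_cols_carrier(1)[of m "[v]"] by simp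
  have I_carrier: "?I n \<subseteq> carrier_mat m n" for n by (auto simp: mats_of_rank_def)
  have ker_carrier: "mat_kernel M \<subseteq> carrier_vec m" by (rule mat_kernel_carrier[OF M])
  have mem: "append_cols B (mat_of_cols m [v]) \<in> ?I (Suc n) \<longleftrightarrow>
      B \<in> ?I n \<and> v \<in> mat_kernel M - mat_range B"
    if "B \<in> carrier_mat m n" "v \<in> carrier_vec m" for B v
    using inj_on_append_single_col_iff[OF that] mult_append_single_col_eq_0_iff[OF M that]
      append_cols_carrier[OF that(1) V[of v]] that
    by (auto simp: mats_of_full_col_rank_iff)
  \<comment> \<open>The admissible last columns depend on \<open>B\<close>, hence the dependent sum;
    only their number is the same for all \<open>B\<close>.\<close>
  have "bij_betw ?f (SIGMA B:?I n. mat_kernel M - mat_range B) (?I (Suc n))"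
  proof (rule bij_betw_imageI)
    show "inj_on ?f (SIGMA B:?I n. mat_kernel M - mat_range B)"
    proof (rule inj_onI, clarify)
      fix B v B' v'
      assume "B \<in> mats_of_rank m n n" "B' \<in> mats_of_rank m n n" and "v \<in> mat_kernel M" "v' \<in> mat_kernel M"
        and eq: "append_cols B (mat_of_cols m [v]) = append_cols B' (mat_of_cols m [v'])"
      then have c: "B \<in> carrier_mat m n" "B' \<in> carrier_mat m n" "v \<in> carrier_vec m" "v' \<in> carrier_vec m"
        using ker_carrier by (auto simp: mats_of_rank_def)
      have "(B, mat_of_cols m [v]) = (B', mat_of_cols m [v'])"
        using bij_betw_imp_inj_on[OF bij_betw_append_cols[of m n 1]] eq c V
        by (auto dest: inj_onD[of _ _ "(B, mat_of_cols m [v])" "(B', mat_of_cols m [v'])"])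
      then have B: "B = B'" and "cols (mat_of_cols m [v]) = cols (mat_of_cols m [v'])" by simp_all
      moreover have "cols (mat_of_cols m [u]) = [u]" if "u \<in> carrier_vec m" for u :: "'a vec"
        by (rule cols_mat_of_cols) (simp add: that)
      ultimately have "[v] = [v']" using c(3,4) by metis
      then show "B = B' \<and> v = v'" using B by simp
    qed
    show "?f ` (SIGMA B:?I n. mat_kernel M - mat_range B) = ?I (Suc n)"
    proof (intro equalityI subsetI)
      fix A assume "A \<in> ?f ` (SIGMA B:?I n. mat_kernel M - mat_range B)"
      then obtain B v where Bv: "B \<in> ?I n" "v \<in> mat_kernel M - mat_range B"
        "A = append_cols B (mat_of_cols m [v])" by auto
      have "B \<in> carrier_mat m n" using Bv(1) I_carrier by (rule rev_subsetD)
      moreover have "v \<in> carrier_vec m" using Bv(2) subsetD[OF ker_carrier, of v] by simp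
      ultimately show "A \<in> ?I (Suc n)" using mem[of B v] Bv by simp
    next
      fix A assume A: "A \<in> ?I (Suc n)"
      then have "A \<in> carrier_mat m (n + 1)" using I_carrier[of "Suc n"] by auto
      then have "A \<in> (\<lambda>(X, Y). append_cols X Y) ` (carrier_mat m n \<times> carrier_mat m 1)"
        using bij_betw_imp_surj_on[OF bij_betw_append_cols[of m n 1]] by blast
      then obtain B Y where BY: "A = append_cols B Y" "B \<in> carrier_mat m n" "Y \<in> carrier_mat m 1"
        by auto
      define v where "v = col Y 0"
      have v: "v \<in> carrier_vec m" using BY(3) unfolding v_def by auto
      have "mat_of_cols m [v] = Y"
        unfolding v_def using BY(3) by (intro eq_matI) (auto simp: mat_of_cols_def)
      then have AB: "A = append_cols B (mat_of_cols m [v])" using BY(1) by simp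
      then have "B \<in> ?I n" "v \<in> mat_kernel M - mat_range B" using A mem[OF BY(2) v] by auto
      then show "A \<in> ?f ` (SIGMA B:?I n. mat_kernel M - mat_range B)" using AB by force
    qed
  qed
  then have "card (?I (Suc n)) = card (SIGMA B:?I n. mat_kernel M - mat_range B)"
    by (rule bij_betw_same_card[symmetric])
  also have "\<dots> = (\<Sum>B\<in>?I n. card (mat_kernel M - mat_range B))"
    by (rule card_SigmaI)
      (auto intro: finite_subset[OF I_carrier finite_carrier_mat] simp: finite_mat_kernel)
  finally have "real (card (?I (Suc n))) = (\<Sum>B\<in>?I n. real (card (mat_kernel M - mat_range B)))"
    by simp
  \<comment> \<open>For each \<open>B\<close> the range lies in the kernel, so the subtraction does
    not truncate; if there is no \<open>B\<close>, both sums are empty.\<close>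
  also have "\<dots> = (\<Sum>B\<in>?I n. real (card (mat_kernel M)) - real CARD('a) ^ n)"
  proof (rule sum.cong)
    fix B assume B: "B \<in> ?I n"
    then have Bc: "B \<in> carrier_mat m n" and MB: "M * B = 0\<^sub>m l n"
      and r: "card (mat_range B) = CARD('a) ^ n" by (auto simp: mats_of_rank_eq_card_range)
    have sub: "mat_range B \<subseteq> mat_kernel M"
    proof
      fix w assume "w \<in> mat_range B"
      then obtain x where x: "x \<in> carrier_vec n" "w = B *\<^sub>v x" using Bc unfolding mat_range_def by auto
      have "M *\<^sub>v w = (M * B) *\<^sub>v x" using M Bc x by simp
      also have "\<dots> = 0\<^sub>v l" unfolding MB using x(1) by (intro eq_vecI) auto
      finally show "w \<in> mat_kernel M" using x Bc by (auto simp: mat_kernel[OF M])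
    qed
    have "card (mat_kernel M - mat_range B) = card (mat_kernel M) - card (mat_range B)"
      by (rule card_Diff_subset[OF finite_mat_range sub])
    then show "real (card (mat_kernel M - mat_range B)) = real (card (mat_kernel M)) - real CARD('a) ^ n"
      using card_mono[OF finite_mat_kernel sub] r by simp
  qed simp
  also have "\<dots> = (\<Prod>i = 0..<Suc n. real (card (mat_kernel M)) - real CARD('a) ^ i)"
    using Suc.IH by simp
  finally show ?case .
qed

text \<open>In the coordinates given by \<open>P\<close>, the range of \<open>A\<close> is the set
  of all vectors of length \<open>d\<close> padded by zeros. It identifies the number of nonzero
  rows of a reduced form with the rank.\<close>

lemma row_reduction_card_mat_range:
  fixes A :: "'a::{field,finite} mat"
  assumes A: "A \<in> carrier_mat a b" and P: "P \<in> carrier_mat a a" and Q: "Q \<in> carrier_mat a a"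
    and QP: "Q * P = 1\<^sub>m a" and PQ: "P * Q = 1\<^sub>m a" and d: "d \<le> a" and R: "R \<in> carrier_mat d b"
    and surj: "mat_range R = carrier_vec d" and PA: "P * A = R @\<^sub>r 0\<^sub>m (a - d) b"
  shows "card (mat_range A) = CARD('a) ^ d"
proof -
  have val: "A *\<^sub>v x = Q *\<^sub>v (R *\<^sub>v x @\<^sub>v 0\<^sub>v (a - d))" if x: "x \<in> carrier_vec b" for x
  proof -
    have "A = Q * (P * A)" using assoc_mult_mat[OF Q P A] QP A by simp
    then have "A *\<^sub>v x = (Q * (P * A)) *\<^sub>v x" by simp
    also have "\<dots> = Q *\<^sub>v ((P * A) *\<^sub>v x)" using Q P A x by (intro assoc_mult_mat_vec) auto
    also have "(P * A) *\<^sub>v x = R *\<^sub>v x @\<^sub>v 0\<^sub>v (a - d)"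
    proof -
      have "0\<^sub>m (a - d) b *\<^sub>v x = 0\<^sub>v (a - d)" using x by (intro eq_vecI) auto
      then show ?thesis unfolding PA using mat_mult_append[OF R _ x, of "0\<^sub>m (a - d) b" "a - d"] by simp
    qed
    finally show ?thesis .
  qed
  have "mat_range A = (\<lambda>x. Q *\<^sub>v (R *\<^sub>v x @\<^sub>v 0\<^sub>v (a - d))) ` carrier_vec b"
    unfolding mat_range_def using A val by (intro image_cong) auto
  also have "\<dots> = (\<lambda>w. Q *\<^sub>v (w @\<^sub>v 0\<^sub>v (a - d))) ` mat_range R"
    unfolding mat_range_def using R by (simp add: image_image)
  finally have "mat_range A = (\<lambda>w. Q *\<^sub>v (w @\<^sub>v 0\<^sub>v (a - d))) ` carrier_vec d" unfolding surj .
  moreover have "inj_on (\<lambda>w. Q *\<^sub>v (w @\<^sub>v 0\<^sub>v (a - d))) (carrier_vec d)"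
  proof (rule inj_onI)
    fix w w' :: "'a vec" assume w: "w \<in> carrier_vec d" "w' \<in> carrier_vec d"
      and eq: "Q *\<^sub>v (w @\<^sub>v 0\<^sub>v (a - d)) = Q *\<^sub>v (w' @\<^sub>v 0\<^sub>v (a - d))"
    have c: "u @\<^sub>v 0\<^sub>v (a - d) \<in> carrier_vec a" if "u \<in> carrier_vec d" for u :: "'a vec"
      using that d append_carrier_vec[of u d "0\<^sub>v (a - d)" "a - d"] by simp
    \<comment> \<open>Multiplying by \<open>P\<close> undoes \<open>Q\<close>, and the padding by
      zeros is injective.\<close>
    have inv: "P *\<^sub>v (Q *\<^sub>v (u @\<^sub>v 0\<^sub>v (a - d))) = u @\<^sub>v 0\<^sub>v (a - d)" if "u \<in> carrier_vec d" for u
      using assoc_mult_mat_vec[OF P Q c[OF that]] PQ c[OF that] by simp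
    have "w @\<^sub>v 0\<^sub>v (a - d) = w' @\<^sub>v 0\<^sub>v (a - d)" using inv[OF w(1)] inv[OF w(2)] eq by metis
    then show "w = w'" by (rule conjunct1[OF iffD1[OF append_vec_eq[OF w]]])
  qed
  ultimately show ?thesis by (simp add: card_image card_carrier_vec)
qed

section \<open>Matrices of full row rank with a product of given rank\<close>

text \<open>In the coordinates given by \<open>P\<close>, the columns of \<open>X\<close> span
  exactly the first \<open>r\<close> coordinates. Hence only the lower block \<open>Y2\<close> of
  \<open>P * Y\<close> decides surjectivity, while the upper block \<open>Y1\<close> is free and
  contributes the power of \<open>CARD('a)\<close>.\<close>

lemma card_full_rank_completions:
  fixes X :: "'a::{field,finite} mat"
  assumes X: "X \<in> mats_of_rank l d r"
  shows "card {Y \<in> carrier_mat l k. append_cols X Y \<in> mats_of_rank l (d + k) l} =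
    card (mats_of_rank (l - r) k (l - r) :: 'a mat set) * CARD('a) ^ (k * r)"
proof -
  have Xc: "X \<in> carrier_mat l d" using X by (simp add: mats_of_rank_def)
  obtain P Q r' R S where P: "P \<in> carrier_mat l l" and Q: "Q \<in> carrier_mat l l"
    and PQ: "P * Q = 1\<^sub>m l" and QP: "Q * P = 1\<^sub>m l" and rl': "r' \<le> l"
    and R: "R \<in> carrier_mat r' d" and S: "S \<in> carrier_mat d r'" and RS: "R * S = 1\<^sub>m r'"
    and PX: "P * X = R @\<^sub>r 0\<^sub>m (l - r') d"
    using exists_row_reduction[OF Xc] by metis
  have surj: "mat_range R = carrier_vec r'" using R S RS by (rule mat_range_right_inverse)
  have "r' = r"
    using row_reduction_card_mat_range[OF Xc P Q QP PQ rl' R surj PX] X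
    by (simp add: mats_of_rank_eq_card_range card_field_power_inject)
  then have rl: "r \<le> l" and R: "R \<in> carrier_mat r d" and surj: "mat_range R = carrier_vec r"
    and PX: "P * X = R @\<^sub>r 0\<^sub>m (l - r) d" using rl' R surj PX by simp_all
  have rows: "bij_betw (\<lambda>(Y1, Y2). Y1 @\<^sub>r Y2) (carrier_mat r k \<times> carrier_mat (l - r) k)
      (carrier_mat l k :: 'a mat set)"
    using bij_betw_append_rows[of r k "l - r"] rl by simp
  \<comment> \<open>Parametrise the completions by their two row blocks in the new
    coordinates.\<close>
  have bij: "bij_betw (\<lambda>(Y1, Y2). Q * (Y1 @\<^sub>r Y2)) (carrier_mat r k \<times> carrier_mat (l - r) k) (carrier_mat l k)"
    using bij_betw_trans[OF rows bij_betw_mult_left[OF Q P QP PQ]]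
    by (simp add: o_def case_prod_unfold)
  have crit: "append_cols X (Q * (Y1 @\<^sub>r Y2)) \<in> mats_of_rank l (d + k) l \<longleftrightarrow>
      Y2 \<in> mats_of_rank (l - r) k (l - r)"
    if Y1: "Y1 \<in> carrier_mat r k" and Y2: "Y2 \<in> carrier_mat (l - r) k" for Y1 Y2
  proof -
    let ?Y = "Q * (Y1 @\<^sub>r Y2)"
    have Y12: "Y1 @\<^sub>r Y2 \<in> carrier_mat l k" using carrier_append_rows[OF Y1 Y2] rl by simp
    then have Y: "?Y \<in> carrier_mat l k" using Q by simp
    have app: "u @\<^sub>v w \<in> carrier_vec l" if "u \<in> carrier_vec r" "w \<in> carrier_vec (l - r)" for u w :: "'a vec"
      using append_carrier_vec[OF that] rl by simp
    \<comment> \<open>The \<open>P\<close>-coordinates of a general element of the range: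
      \<open>x\<close> affects only the upper block.\<close>
    have P_val: "P *\<^sub>v (X *\<^sub>v x + ?Y *\<^sub>v y) = (R *\<^sub>v x + Y1 *\<^sub>v y) @\<^sub>v (Y2 *\<^sub>v y)"
      if x: "x \<in> carrier_vec d" and y: "y \<in> carrier_vec k" for x y
    proof -
      have "P *\<^sub>v (X *\<^sub>v x + ?Y *\<^sub>v y) = P *\<^sub>v (X *\<^sub>v x) + P *\<^sub>v (?Y *\<^sub>v y)"
        using Xc Y x y by (intro mult_add_distrib_mat_vec[OF P]) auto
      also have "P *\<^sub>v (X *\<^sub>v x) = (P * X) *\<^sub>v x" using P Xc x by simp
      also have "\<dots> = R *\<^sub>v x @\<^sub>v (0\<^sub>m (l - r) d *\<^sub>v x)"
        unfolding PX by (rule mat_mult_append[OF R zero_carrier_mat x])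
      also have "0\<^sub>m (l - r) d *\<^sub>v x = 0\<^sub>v (l - r)" using x by (intro eq_vecI) auto
      also have "P *\<^sub>v (?Y *\<^sub>v y) = (P * ?Y) *\<^sub>v y" using P Y y by simp
      also have "P * ?Y = Y1 @\<^sub>r Y2" using assoc_mult_mat[OF P Q Y12] PQ Y12 by simp
      also have "(Y1 @\<^sub>r Y2) *\<^sub>v y = Y1 *\<^sub>v y @\<^sub>v Y2 *\<^sub>v y" by (rule mat_mult_append[OF Y1 Y2 y])
      also have "(R *\<^sub>v x @\<^sub>v 0\<^sub>v (l - r)) + (Y1 *\<^sub>v y @\<^sub>v Y2 *\<^sub>v y) =
          (R *\<^sub>v x + Y1 *\<^sub>v y) @\<^sub>v (Y2 *\<^sub>v y)"
        using R Y1 Y2 by (intro eq_vecI) auto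
      finally show ?thesis .
    qed
    have "mat_range (append_cols X ?Y) = carrier_vec l \<longleftrightarrow> mat_range Y2 = carrier_vec (l - r)"
    proof
      assume full: "mat_range (append_cols X ?Y) = carrier_vec l"
      show "mat_range Y2 = carrier_vec (l - r)"
      proof
        show "carrier_vec (l - r) \<subseteq> mat_range Y2"
        proof
          fix w :: "'a vec" assume w: "w \<in> carrier_vec (l - r)"
          \<comment> \<open>Full range is tested on the vector with \<open>P\<close>-coordinates 0
            followed by \<open>w\<close>; comparing lower blocks gives a preimage of
            \<open>w\<close> under \<open>Y2\<close>.\<close>
          have c: "0\<^sub>v r @\<^sub>v w \<in> carrier_vec l" using w by (intro app) simp_all
          then have "Q *\<^sub>v (0\<^sub>v r @\<^sub>v w) \<in> mat_range (append_cols X ?Y)" unfolding full using Q by simp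
          then obtain x y where xy: "x \<in> carrier_vec d" "y \<in> carrier_vec k"
            "Q *\<^sub>v (0\<^sub>v r @\<^sub>v w) = X *\<^sub>v x + ?Y *\<^sub>v y"
            unfolding mat_range_append_cols[OF Xc Y] by blast
          have "0\<^sub>v r @\<^sub>v w = (P * Q) *\<^sub>v (0\<^sub>v r @\<^sub>v w)" unfolding PQ using c by simp
          also have "\<dots> = P *\<^sub>v (Q *\<^sub>v (0\<^sub>v r @\<^sub>v w))" using P Q c by (rule assoc_mult_mat_vec)
          also have "\<dots> = (R *\<^sub>v x + Y1 *\<^sub>v y) @\<^sub>v (Y2 *\<^sub>v y)" unfolding xy(3) using xy(1,2) by (rule P_val)
          finally have "w = Y2 *\<^sub>v y"
            by (rule conjunct2[OF iffD1[OF append_vec_eq[of _ r], rotated 2]])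
              (use R Y1 xy(1,2) in \<open>auto intro!: add_carrier_vec mult_mat_vec_carrier\<close>)
          then show "w \<in> mat_range Y2" using mult_mat_vec_in_mat_range[OF Y2 xy(2)] by simp
        qed
      qed (rule mat_range_subset[OF Y2])
    next
      assume full: "mat_range Y2 = carrier_vec (l - r)"
      show "mat_range (append_cols X ?Y) = carrier_vec l"
      proof
        show "carrier_vec l \<subseteq> mat_range (append_cols X ?Y)"
        proof
          fix w :: "'a vec" assume w: "w \<in> carrier_vec l"
          then have "P *\<^sub>v w \<in> carrier_vec (r + (l - r))" using P rl by simp
          then obtain w1 w2 where w12: "P *\<^sub>v w = w1 @\<^sub>v w2" "w1 \<in> carrier_vec r" "w2 \<in> carrier_vec (l - r)"
            by (rule append_vec_cases)
          \<comment> \<open>First choose \<open>y\<close> to match the lower coordinates; the error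
            this causes in the upper ones is then corrected by \<open>x\<close>, as \<open>R\<close>
            is surjective.\<close>
          obtain y where y: "y \<in> carrier_vec k" "w2 = Y2 *\<^sub>v y"
            using w12(3) Y2 unfolding full[symmetric] mat_range_def by auto
          have "w1 - Y1 *\<^sub>v y \<in> mat_range R" unfolding surj using w12(2) Y1 y by simp
          then obtain x where x: "x \<in> carrier_vec d" "w1 - Y1 *\<^sub>v y = R *\<^sub>v x"
            using R unfolding mat_range_def by auto
          have "R *\<^sub>v x + Y1 *\<^sub>v y = w1" unfolding x(2)[symmetric] using w12(2) Y1 by (intro eq_vecI) auto
          then have eq: "P *\<^sub>v (X *\<^sub>v x + ?Y *\<^sub>v y) = P *\<^sub>v w" using P_val[OF x(1) y(1)] y(2) w12(1) by simp
          have c: "X *\<^sub>v x + ?Y *\<^sub>v y \<in> carrier_vec l" using Xc Y x y by simp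
          have QPu: "Q *\<^sub>v (P *\<^sub>v u) = u" if "u \<in> carrier_vec l" for u
            using assoc_mult_mat_vec[OF Q P that] QP that by simp
          have "X *\<^sub>v x + ?Y *\<^sub>v y = Q *\<^sub>v (P *\<^sub>v (X *\<^sub>v x + ?Y *\<^sub>v y))" by (rule QPu[OF c, symmetric])
          also have "\<dots> = w" unfolding eq by (rule QPu[OF w])
          finally show "w \<in> mat_range (append_cols X ?Y)"
            unfolding mat_range_append_cols[OF Xc Y] using x(1) y(1) by blast
        qed
      qed (rule mat_range_subset[OF append_cols_carrier[OF Xc Y]])
    qed
    then show ?thesis
      using Y2 append_cols_carrier[OF Xc Y] by (simp add: mats_of_full_row_rank_iff)
  qed
  have "bij_betw (\<lambda>(Y1, Y2). Q * (Y1 @\<^sub>r Y2))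
      {p \<in> carrier_mat r k \<times> carrier_mat (l - r) k. snd p \<in> mats_of_rank (l - r) k (l - r)}
      {Y \<in> carrier_mat l k. append_cols X Y \<in> mats_of_rank l (d + k) l}"
    by (rule bij_betw_Collect[OF bij]) (use crit in auto)
  moreover have "{p \<in> carrier_mat r k \<times> carrier_mat (l - r) k. snd p \<in> mats_of_rank (l - r) k (l - r)} =
      (carrier_mat r k :: 'a mat set) \<times> (mats_of_rank (l - r) k (l - r) :: 'a mat set)"
    by (auto simp: mats_of_rank_def)
  ultimately have "bij_betw (\<lambda>(Y1, Y2). Q * (Y1 @\<^sub>r Y2))
      (carrier_mat r k \<times> mats_of_rank (l - r) k (l - r))
      {Y \<in> carrier_mat l k. append_cols X Y \<in> mats_of_rank l (d + k) l}" by (simp only:)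
  then have "card ((carrier_mat r k :: 'a mat set) \<times> (mats_of_rank (l - r) k (l - r) :: 'a mat set)) =
      card {Y \<in> carrier_mat l k. append_cols X Y \<in> mats_of_rank l (d + k) l}"
    by (rule bij_betw_same_card)
  then show ?thesis by (simp add: card_cartesian_product card_carrier_mat mult.commute)
qed

lemma finite_mats_of_rank: "finite (mats_of_rank a b r :: 'a::{field,finite} mat set)"
  by (rule finite_subset[OF _ finite_carrier_mat[of a b]]) (auto simp: mats_of_rank_def)

text \<open>Reduce \<open>D\<close> to \<open>R\<close> above zeros and write \<open>A\<close> as
  \<open>append_cols X Y * P\<close>. Then \<open>A * D = X * R\<close>, which has the range of
  \<open>X\<close>, and \<open>A\<close> has the range of \<open>append_cols X Y\<close>. It remains
  to choose \<open>X\<close> of rank \<open>r\<close> and to complete it by \<open>m - d\<close>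
  columns.\<close>

lemma card_full_row_rank_mult_of_rank:
  fixes D :: "'a::{field,finite} mat"
  assumes D: "D \<in> mats_of_rank m b d"
  shows "card {A \<in> mats_of_rank l m l. A * D \<in> mats_of_rank l b r} =
    card (mats_of_rank l d r :: 'a mat set) *
    (card (mats_of_rank (l - r) (m - d) (l - r) :: 'a mat set) * CARD('a) ^ ((m - d) * r))"
proof -
  have Dc: "D \<in> carrier_mat m b" using D by (simp add: mats_of_rank_def)
  obtain P Q d' R S where P: "P \<in> carrier_mat m m" and Q: "Q \<in> carrier_mat m m"
    and PQ: "P * Q = 1\<^sub>m m" and QP: "Q * P = 1\<^sub>m m" and dm': "d' \<le> m"
    and R: "R \<in> carrier_mat d' b" and S: "S \<in> carrier_mat b d'" and RS: "R * S = 1\<^sub>m d'"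
    and PD: "P * D = R @\<^sub>r 0\<^sub>m (m - d') b"
    using exists_row_reduction[OF Dc] by metis
  have surj: "mat_range R = carrier_vec d'" using R S RS by (rule mat_range_right_inverse)
  have "d' = d"
    using row_reduction_card_mat_range[OF Dc P Q QP PQ dm' R surj PD] D
    by (simp add: mats_of_rank_eq_card_range card_field_power_inject)
  then have dm: "d \<le> m" and R: "R \<in> carrier_mat d b" and surj: "mat_range R = carrier_vec d"
    and PD: "P * D = R @\<^sub>r 0\<^sub>m (m - d) b" using dm' R surj PD by simp_all
  have P_surj: "mat_range P = carrier_vec m" using P Q PQ by (rule mat_range_right_inverse)
  let ?C = "carrier_mat l d \<times> carrier_mat l (m - d) :: ('a mat \<times> 'a mat) set"
  have cols: "bij_betw (\<lambda>(X, Y). append_cols X Y) ?C (carrier_mat l m)"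
    using bij_betw_append_cols[of l d "m - d"] dm by simp
  have bij: "bij_betw (\<lambda>(X, Y). append_cols X Y * P) ?C (carrier_mat l m)"
    using bij_betw_trans[OF cols bij_betw_mult_right[OF P Q PQ QP]]
    by (simp add: o_def case_prod_unfold)
  have crit: "append_cols X Y * P \<in> mats_of_rank l m l \<and> append_cols X Y * P * D \<in> mats_of_rank l b r \<longleftrightarrow>
      X \<in> mats_of_rank l d r \<and> append_cols X Y \<in> mats_of_rank l (d + (m - d)) l"
    if X: "X \<in> carrier_mat l d" and Y: "Y \<in> carrier_mat l (m - d)" for X Y
  proof -
    have XY: "append_cols X Y \<in> carrier_mat l m" using append_cols_carrier[OF X Y] dm by simp
    have "append_cols X Y * P * D = append_cols X Y * (P * D)" using XY P Dc by (rule assoc_mult_mat)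
    also have "\<dots> = X * R + Y * 0\<^sub>m (m - d) b"
      unfolding PD using X Y R by (rule append_cols_mult_append_rows) simp
    also have "\<dots> = X * R" using X Y R by simp
    finally have "append_cols X Y * P * D = X * R" .
    then show ?thesis
      using X Y R XY P dm mat_range_mult_surj[OF X R surj] mat_range_mult_surj[OF XY P P_surj]
      by (simp add: mats_of_rank_eq_card_range conj_commute)
  qed
  have "bij_betw (\<lambda>(X, Y). append_cols X Y * P)
      {p \<in> ?C. fst p \<in> mats_of_rank l d r \<and> append_cols (fst p) (snd p) \<in> mats_of_rank l (d + (m - d)) l}
      {A \<in> carrier_mat l m. A \<in> mats_of_rank l m l \<and> A * D \<in> mats_of_rank l b r}"
    by (rule bij_betw_Collect[OF bij], clarify, simp only: prod.case fst_conv snd_conv, rule crit)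
  moreover have "{p \<in> ?C. fst p \<in> mats_of_rank l d r \<and>
        append_cols (fst p) (snd p) \<in> mats_of_rank l (d + (m - d)) l} =
      (SIGMA X:(mats_of_rank l d r :: 'a mat set).
        {Y \<in> carrier_mat l (m - d). append_cols X Y \<in> mats_of_rank l (d + (m - d)) l})"
    by (auto simp: mats_of_rank_def)
  moreover have "{A \<in> carrier_mat l m. A \<in> mats_of_rank l m l \<and> A * D \<in> mats_of_rank l b r} =
      {A \<in> mats_of_rank l m l. A * D \<in> mats_of_rank l b r}"
    by (auto simp: mats_of_rank_def)
  ultimately have "bij_betw (\<lambda>(X, Y). append_cols X Y * P)
      (SIGMA X:(mats_of_rank l d r :: 'a mat set).
        {Y \<in> carrier_mat l (m - d). append_cols X Y \<in> mats_of_rank l (d + (m - d)) l})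
      {A \<in> mats_of_rank l m l. A * D \<in> mats_of_rank l b r}" by (simp only:)
  then have "card {A \<in> mats_of_rank l m l. A * D \<in> mats_of_rank l b r} =
      card (SIGMA X:(mats_of_rank l d r :: 'a mat set).
        {Y \<in> carrier_mat l (m - d). append_cols X Y \<in> mats_of_rank l (d + (m - d)) l})"
    by (rule bij_betw_same_card[symmetric])
  also have "\<dots> = (\<Sum>X\<in>(mats_of_rank l d r :: 'a mat set).
      card {Y \<in> carrier_mat l (m - d). append_cols X Y \<in> mats_of_rank l (d + (m - d)) l})"
    using finite_carrier_mat[of l "m - d", where 'a='a]
    by (intro card_SigmaI) (simp_all add: finite_mats_of_rank)
  also have "\<dots> = (\<Sum>X\<in>(mats_of_rank l d r :: 'a mat set).
      card (mats_of_rank (l - r) (m - d) (l - r) :: 'a mat set) * CARD('a) ^ ((m - d) * r))"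
    \<comment> \<open>The number of completions depends on \<open>X\<close> only through its
      rank.\<close>
    by (rule sum.cong[OF refl]) (rule card_full_rank_completions)
  finally show ?thesis by simp
qed

section \<open>Permutation matrices and cycles\<close>

lemma perm_mat_carrier [simp]: "perm_mat m p \<in> carrier_mat m m"
  unfolding perm_mat_def by simp

lemma perm_mat_mult_vec:
  fixes v :: "'a::comm_ring_1 vec"
  assumes "p permutes {..<m}" and "v \<in> carrier_vec m"
  shows "perm_mat m p *\<^sub>v v = vec m (\<lambda>i. v $ p i)"
proof (rule eq_vecI)
  fix i assume "i < dim_vec (vec m (\<lambda>i. v $ p i))"
  then have i: "i < m" by simp
  then have pi: "p i < m" using permutes_in_image[OF assms(1), of i] by simp
  have "(perm_mat m p *\<^sub>v v) $ i = (\<Sum>j<m. (if p i = j then 1 else 0) * v $ j)"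
    using i assms(2) by (simp add: perm_mat_def scalar_prod_def lessThan_atLeast0)
  also have "\<dots> = (\<Sum>j<m. if p i = j then v $ j else 0)" by (rule sum.cong) auto
  also have "\<dots> = v $ p i" using pi by simp
  finally show "(perm_mat m p *\<^sub>v v) $ i = vec m (\<lambda>i. v $ p i) $ i" using i by simp
qed (simp add: perm_mat_def)

text \<open>Row \<open>i\<close> of \<open>perm_mat m p\<close> is the unit vector at
  \<open>p i\<close>, so the left factor acts first on indices and the order of composition is
  reversed.\<close>

lemma perm_mat_mult:
  assumes "p permutes {..<m}" "s permutes {..<m}"
  shows "perm_mat m p * perm_mat m s = (perm_mat m (s \<circ> p) :: 'a::comm_ring_1 mat)"
proof (rule eq_matI)
  fix i j assume "i < dim_row (perm_mat m (s \<circ> p) :: 'a mat)" "j < dim_col (perm_mat m (s \<circ> p) :: 'a mat)"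
  then have ij: "i < m" "j < m" by (auto simp: perm_mat_def)
  then have pi: "p i < m" using permutes_in_image[OF assms(1), of i] by simp
  have "(perm_mat m p * perm_mat m s :: 'a mat) $$ (i, j) =
      (\<Sum>k<m. (if p i = k then 1 else 0) * (if s k = j then 1 else 0))"
    using ij by (simp add: perm_mat_def scalar_prod_def lessThan_atLeast0)
  also have "\<dots> = (\<Sum>k<m. if p i = k then (if s k = j then 1 else 0) else 0)"
    by (rule sum.cong) auto
  also have "\<dots> = (if s (p i) = j then 1 else 0)" using pi by simp
  finally show "(perm_mat m p * perm_mat m s) $$ (i, j) = (perm_mat m (s \<circ> p) :: 'a mat) $$ (i, j)"
    using ij by (simp add: perm_mat_def)
qed (auto simp: perm_mat_def)

lemma perm_mat_id: "perm_mat m id = (1\<^sub>m m :: 'a::comm_ring_1 mat)"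
  by (intro eq_matI) (auto simp: perm_mat_def)

lemma perm_mat_inverse:
  assumes "p permutes {..<m}"
  shows "perm_mat m p * perm_mat m (inv_into UNIV p) = (1\<^sub>m m :: 'a::comm_ring_1 mat)"
    "perm_mat m (inv_into UNIV p) * perm_mat m p = (1\<^sub>m m :: 'a::comm_ring_1 mat)"
  using perm_mat_mult[OF assms permutes_inv[OF assms]] perm_mat_mult[OF permutes_inv[OF assms] assms]
    permutes_inv_o[OF assms] by (simp_all add: perm_mat_id)

text \<open>The permutation matrix replaces entry \<open>i\<close> of a vector by entry
  \<open>p i\<close>, so the kernel consists of its fixed vectors.\<close>

lemma mat_kernel_perm_mat_minus_one:
  assumes p: "p permutes {..<m}"
  shows "mat_kernel (perm_mat m p - 1\<^sub>m m :: 'a::comm_ring_1 mat) =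
    {v \<in> carrier_vec m. \<forall>i<m. v $ p i = v $ i}"
proof -
  have D: "perm_mat m p - 1\<^sub>m m \<in> carrier_mat m m" by (intro minus_carrier_mat one_carrier_mat)
  have "(perm_mat m p - 1\<^sub>m m) *\<^sub>v v = 0\<^sub>v m \<longleftrightarrow> (\<forall>i<m. v $ p i = v $ i)"
    if v: "v \<in> carrier_vec m" for v :: "'a vec"
  proof -
    have "(perm_mat m p - 1\<^sub>m m) *\<^sub>v v = vec m (\<lambda>i. v $ p i) - v"
      using minus_mult_distrib_mat_vec[OF perm_mat_carrier one_carrier_mat v] v
      by (simp add: perm_mat_mult_vec[OF p])
    then show ?thesis using v by (auto simp: vec_eq_iff)
  qed
  then show ?thesis unfolding mat_kernel[OF D] by blast
qed

text \<open>The product of cycles from \<open>sym_group_cycles\<close>, named to allow induction on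
  the list.\<close>

definition cycles_perm :: "'a list list \<Rightarrow> 'a \<Rightarrow> 'a" where
  "cycles_perm css = foldr (\<circ>) (map cycle_of_list css) id"

lemma cycles_perm_simps [simp]:
  "cycles_perm [] = id"
  "cycles_perm (c # css) = cycle_of_list c \<circ> cycles_perm css"
  by (simp_all only: cycles_perm_def list.map foldr_Nil foldr_Cons id_apply o_apply)

lemma cycles_perm_outside: "i \<notin> set (concat css) \<Longrightarrow> cycles_perm css i = i"
  by (induction css) (auto simp: id_outside_supp)

lemma cycles_perm_on_cycle:
  assumes "distinct (concat css)" "cs \<in> set css" "i \<in> set cs"
  shows "cycles_perm css i = cycle_of_list cs i"
  using assms
proof (induction css)
  case (Cons c css)
  have disj: "set c \<inter> set (concat css) = {}" and dist: "distinct (concat css)"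
    using Cons.prems(1) by auto
  show ?case
  proof (cases "cs \<in> set css")
    case True
    \<comment> \<open>The inner factor keeps \<open>i\<close> within \<open>cs\<close>, and the
      outer cycle \<open>c\<close>, being disjoint from \<open>cs\<close>, fixes the result.\<close>
    have "cycle_of_list cs i \<in> set cs"
      using permutes_in_image[OF cycle_permutes, of cs i] Cons.prems(3) by simp
    then have "cycle_of_list cs i \<notin> set c" using True disj by auto
    then show ?thesis using Cons.IH[OF dist True Cons.prems(3)] by (simp add: id_outside_supp)
  next
    case False
    then have "cs = c" using Cons.prems(2) by simp
    then have "i \<notin> set (concat css)" using disj Cons.prems(3) by blast
    then show ?thesis using \<open>cs = c\<close> by (simp add: cycles_perm_outside del: set_concat)
  qed
qed simp

text \<open>The cycle sends each list entry to the next one, so invariance carries the value at the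
  head along the whole list. Conversely, the cycle maps its support to itself, where a constant
  function is invariant.\<close>

lemma invariant_cycle_of_list_iff:
  assumes "distinct cs"
  shows "(\<forall>i\<in>set cs. f (cycle_of_list cs i) = f i) \<longleftrightarrow> (\<forall>i\<in>set cs. f i = f (hd cs))"
proof
  assume inv: "\<forall>i\<in>set cs. f (cycle_of_list cs i) = f i"
  have step: "cycle_of_list cs (cs ! j) = cs ! Suc j" if "Suc j < length cs" for j
  proof -
    \<comment> \<open>Applying the cycle to all entries rotates the list by one place.\<close>
    have "map (cycle_of_list cs) cs ! j = rotate1 cs ! j"
      using cyclic_rotation[OF assms, of 1] by simp
    then show ?thesis using that by (simp add: nth_rotate1)
  qed
  have "f (cs ! j) = f (cs ! 0)" if "j < length cs" for j
    using that
  proof (induction j)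
    case (Suc j)
    have "f (cs ! Suc j) = f (cycle_of_list cs (cs ! j))" using step[OF Suc.prems] by simp
    also have "\<dots> = f (cs ! j)" using inv Suc.prems by simp
    finally show ?case using Suc by simp
  qed simp
  then show "\<forall>i\<in>set cs. f i = f (hd cs)"
    by (metis hd_conv_nth in_set_conv_nth length_0_conv less_zeroE)
next
  assume const: "\<forall>i\<in>set cs. f i = f (hd cs)"
  then show "\<forall>i\<in>set cs. f (cycle_of_list cs i) = f i"
    using permutes_in_image[OF cycle_permutes, of cs] by metis
qed

text \<open>An invariant vector is constant on each cycle, and the \<open>k\<close> values at the
  heads of the cycles are free. The entries range over any finite type, so that \<open>bool\<close>
  can serve below to control the number of cycles.\<close>

lemma card_invariant_vecs:
  assumes p: "p \<in> sym_group_cycles m k"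
  shows "card {v \<in> carrier_vec m. \<forall>i<m. v $ p i = (v $ i :: 'a::finite)} = CARD('a) ^ k"
proof -
  obtain css where k: "length css = k" and ne: "[] \<notin> set css" and dist: "distinct (concat css)"
    and cover: "set (concat css) = {..<m}" and p_eq: "p = cycles_perm css"
    using p unfolding sym_group_cycles_def cycles_perm_def by blast
  have bounded: "i < m" if "j < k" "i \<in> set (css ! j)" for i j
  proof -
    have "i \<in> set (concat css)" using that k nth_mem by fastforce
    then show ?thesis unfolding cover by simp
  qed
  have hd_in: "hd (css ! j) \<in> set (css ! j)" if "j < k" for j
    using that k ne nth_mem[of j css] by (intro hd_in_set) metis
  have ex: "\<exists>j<k. i \<in> set (css ! j)" if "i < m" for i
  proof -
    have "i \<in> set (concat css)" using that cover by simp
    then obtain cs where "cs \<in> set css" "i \<in> set cs" by auto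
    then show ?thesis using k by (metis in_set_conv_nth)
  qed
  \<comment> \<open>Distinctness of the concatenation permits repetition of empty lists only, and
    there are none.\<close>
  have css_dist: "distinct css"
    using dist ne by (simp add: distinct_concat_iff removeAll_id)
  have uniq: "j = j'" if "j < k" "j' < k" "i \<in> set (css ! j)" "i \<in> set (css ! j')" for i j j'
  proof (rule ccontr)
    assume "j \<noteq> j'"
    then have "css ! j \<noteq> css ! j'" using that k css_dist nth_eq_iff_index_eq by blast
    then have "set (css ! j) \<inter> set (css ! j') = {}"
      using dist that k unfolding distinct_concat_iff by simp
    then show False using that by blast
  qed
  \<comment> \<open>The index of the unique cycle through \<open>i\<close>.\<close>
  define idx where "idx i = (THE j. j < k \<and> i \<in> set (css ! j))" for i
  have idx_eq: "idx i = j" if "j < k" "i \<in> set (css ! j)" for i j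
    unfolding idx_def using that uniq by (intro the_equality) auto
  have idx: "idx i < k" "i \<in> set (css ! idx i)" if "i < m" for i
    using ex[OF that] idx_eq by auto
  \<comment> \<open>Invariance is checked cycle by cycle and becomes agreement with the head of
    one's own cycle.\<close>
  have inv_iff: "(\<forall>i<m. f (p i) = f i) \<longleftrightarrow> (\<forall>i<m. f i = f (hd (css ! idx i)))" for f :: "nat \<Rightarrow> 'a"
  proof -
    have "(\<forall>i<m. f (p i) = f i) \<longleftrightarrow> (\<forall>j<k. \<forall>i\<in>set (css ! j). f (p i) = f i)"
      using ex bounded by blast
    also have "\<dots> \<longleftrightarrow> (\<forall>j<k. \<forall>i\<in>set (css ! j). f (cycle_of_list (css ! j) i) = f i)"
    proof -
      have "p i = cycle_of_list (css ! j) i" if "j < k" "i \<in> set (css ! j)" for i j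
        unfolding p_eq using that k by (intro cycles_perm_on_cycle[OF dist]) simp_all
      then show ?thesis by simp
    qed
    also have "\<dots> \<longleftrightarrow> (\<forall>j<k. \<forall>i\<in>set (css ! j). f i = f (hd (css ! j)))"
    proof -
      have "distinct (css ! j)" if "j < k" for j
        using dist that k unfolding distinct_concat_iff by simp
      then show ?thesis by (simp add: invariant_cycle_of_list_iff)
    qed
    also have "\<dots> \<longleftrightarrow> (\<forall>i<m. f i = f (hd (css ! idx i)))"
    proof
      assume const: "\<forall>j<k. \<forall>i\<in>set (css ! j). f i = f (hd (css ! j))"
      show "\<forall>i<m. f i = f (hd (css ! idx i))"
      proof (intro allI impI)
        fix i assume "i < m"
        then show "f i = f (hd (css ! idx i))" using const idx[of i] by blast
      qed
    next
      assume const: "\<forall>i<m. f i = f (hd (css ! idx i))"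
      show "\<forall>j<k. \<forall>i\<in>set (css ! j). f i = f (hd (css ! j))"
      proof (intro allI impI ballI)
        fix j i assume ij: "j < k" "i \<in> set (css ! j)"
        then show "f i = f (hd (css ! j))" using const bounded[OF ij] idx_eq[OF ij] by metis
      qed
    qed
    finally show ?thesis .
  qed
  have hd: "hd (css ! j) < m" "idx (hd (css ! j)) = j" if "j < k" for j
    using bounded[OF that hd_in[OF that]] idx_eq[OF that hd_in[OF that]] by simp_all
  let ?V = "{v \<in> carrier_vec m. \<forall>i<m. v $ p i = (v $ i :: 'a)}"
  have V: "?V = {v \<in> carrier_vec m. \<forall>i<m. v $ i = v $ hd (css ! idx i)}"
    using inv_iff[of "\<lambda>i. v $ i" for v :: "'a vec"] by simp
  \<comment> \<open>Read off the values at the heads; the inverse copies the value of a cycle to all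
    its points.\<close>
  have "bij_betw (\<lambda>v. vec k (\<lambda>j. v $ hd (css ! j))) ?V (carrier_vec k)"
    unfolding V
  proof (rule bij_betw_byWitness[where f' = "\<lambda>w. vec m (\<lambda>i. w $ idx i)"])
    show "\<forall>v\<in>{v \<in> carrier_vec m. \<forall>i<m. v $ i = v $ hd (css ! idx i)}.
        vec m (\<lambda>i. vec k (\<lambda>j. v $ hd (css ! j)) $ idx i) = v"
      using idx(1) by (auto intro!: eq_vecI)
    show "\<forall>w\<in>carrier_vec k. vec k (\<lambda>j. vec m (\<lambda>i. w $ idx i) $ hd (css ! j)) = w"
      using hd by (auto intro!: eq_vecI)
    show "(\<lambda>w. vec m (\<lambda>i. w $ idx i)) ` carrier_vec k \<subseteq>
        {v \<in> carrier_vec m. \<forall>i<m. v $ i = v $ hd (css ! idx i)}"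
      using hd idx(1) by auto
  qed auto
  then have "card ?V = card (carrier_vec k :: 'a vec set)" by (rule bij_betw_same_card)
  then show ?thesis by (simp only: card_carrier_vec)
qed

text \<open>The \<open>2 ^ k\<close> invariant two-colourings are among all \<open>2 ^ m\<close>
  colourings.\<close>

lemma sym_group_cycles_le:
  assumes p: "p \<in> sym_group_cycles m k"
  shows "k \<le> m"
proof -
  have "card {v \<in> carrier_vec m. \<forall>i<m. v $ p i = (v $ i :: bool)} \<le> card (carrier_vec m :: bool vec set)"
    by (rule card_mono[OF finite_carrier_vec]) blast
  then have "(2 :: nat) ^ k \<le> 2 ^ m" by (simp add: card_invariant_vecs[OF p] card_carrier_vec)
  then show ?thesis by simp
qed

lemma perm_mat_minus_one_rank:
  assumes p: "p \<in> sym_group_cycles m k"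
  shows "(perm_mat m p - 1\<^sub>m m :: 'a::{field,finite} mat) \<in> mats_of_rank m m (m - k)"
proof -
  let ?D = "perm_mat m p - 1\<^sub>m m :: 'a mat"
  have perm: "p permutes {..<m}" using p by (simp add: sym_group_cycles_def sym_group_def)
  have D: "?D \<in> carrier_mat m m" by (intro minus_carrier_mat one_carrier_mat)
  have ker: "card (mat_kernel ?D) = CARD('a) ^ k"
    unfolding mat_kernel_perm_mat_minus_one[OF perm] by (rule card_invariant_vecs[OF p])
  have rk: "card (mat_range ?D) = CARD('a) ^ vec_space.rank m ?D" by (rule card_mat_range[OF D])
  \<comment> \<open>Compare the two counts of the kernel. As the rank is at most \<open>m\<close>,
    the natural subtraction can be inverted.\<close>
  have "k = m - vec_space.rank m ?D"
    using card_mat_kernel(2)[OF D rk] ker by (simp add: card_field_power_inject)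
  then have "vec_space.rank m ?D = m - k"
    using card_mat_kernel(1)[OF D rk] by simp
  then show "?D \<in> mats_of_rank m m (m - k)" using D by (auto simp: mats_of_rank_def)
qed

section \<open>Partition of the symmetric group by the number of cycles\<close>

lemma cycle_decomp_imp_cycle_list:
  assumes "cycle_decomp I p"
  shows "\<exists>css. [] \<notin> set css \<and> distinct (concat css) \<and> set (concat css) = I \<and> p = cycles_perm css"
  using assms
proof (induction rule: cycle_decomp.induct)
  case empty
  show ?case by (rule exI[of _ "[]"]) simp
next
  case (comp I p cs)
  then obtain css where css: "[] \<notin> set css" "distinct (concat css)" "set (concat css) = I"
    "p = cycles_perm css" by blast
  show ?case
  proof (cases "cs = []")
    \<comment> \<open>The inductive decomposition admits an empty cycle, which acts as the identity
      and is dropped.\<close>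
    case True
    then show ?thesis using css by (intro exI[of _ css]) simp
  next
    case False
    then show ?thesis using css comp.hyps by (intro exI[of _ "cs # css"]) auto
  qed
qed

lemma sym_group_eq_Union_cycles:
  assumes "m > 0"
  shows "sym_group m = (\<Union>k\<in>{1..m}. sym_group_cycles m k)"
proof (intro equalityI subsetI)
  fix p assume p: "p \<in> sym_group m"
  then have "cycle_decomp {..<m} p" unfolding sym_group_def by (auto intro: cycle_decomposition)
  then obtain css where css: "[] \<notin> set css" "distinct (concat css)" "set (concat css) = {..<m}"
    "p = cycles_perm css" using cycle_decomp_imp_cycle_list by blast
  then have pk: "p \<in> sym_group_cycles m (length css)" using p unfolding sym_group_cycles_def cycles_perm_def by blast
  \<comment> \<open>A nonempty set of points needs at least one cycle, so the union may start at
    1.\<close>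
  moreover have "css \<noteq> []" using css(3) assms by auto
  moreover have "length css \<le> m"
    by (rule sym_group_cycles_le[OF pk])
  ultimately show "p \<in> (\<Union>k\<in>{1..m}. sym_group_cycles m k)"
    by (intro UN_I[of "length css"]) (auto simp: Suc_le_eq)
qed (auto simp: sym_group_cycles_def)

text \<open>A permutation with \<open>k\<close> cycles has \<open>2 ^ k\<close> invariant two-colourings.\<close>

lemma sym_group_cycles_unique:
  assumes "p \<in> sym_group_cycles m k" "p \<in> sym_group_cycles m k'"
  shows "k = k'"
proof -
  have "CARD(bool) ^ k = CARD(bool) ^ k'"
    using card_invariant_vecs[OF assms(1), where 'a=bool] card_invariant_vecs[OF assms(2), where 'a=bool]
    by simp
  then show ?thesis by simp
qed

section \<open>The expected number of solutions\<close>

lemma finite_sym_group: "finite (sym_group m)"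
  unfolding sym_group_def by (rule finite_permutations) simp

lemma sym_group_nonempty: "sym_group m \<noteq> {}"
  unfolding sym_group_def using permutes_id by blast

text \<open>The annihilator count for the matrix without rows, whose kernel is the whole
  space.\<close>

lemma card_mats_of_full_col_rank:
  "real (card (mats_of_rank m n n :: 'a::{field,finite} mat set)) =
    (\<Prod>i = 0..<n. real CARD('a) ^ m - real CARD('a) ^ i)"
proof -
  have M: "0\<^sub>m 0 m \<in> carrier_mat 0 m" by simp
  have "mat_kernel (0\<^sub>m 0 m :: 'a mat) = carrier_vec m"
    unfolding mat_kernel[OF M] by (auto intro: eq_vecI)
  moreover have "{B \<in> mats_of_rank m n n. 0\<^sub>m 0 m * B = 0\<^sub>m 0 n} = (mats_of_rank m n n :: 'a mat set)"
    by (auto simp: mats_of_rank_def intro: eq_matI)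
  ultimately show ?thesis
    using card_full_col_rank_annihilated[OF M, of n, where 'a='a] by (simp add: card_carrier_vec)
qed

lemma mats_of_full_col_rank_nonempty:
  assumes "n \<le> m"
  shows "(mats_of_rank m n n :: 'a::{field,finite} mat set) \<noteq> {}"
proof -
  \<comment> \<open>For \<open>i < n \<le> m\<close> the two powers differ, so no factor of the
    count vanishes.\<close>
  have "real CARD('a) ^ m - real CARD('a) ^ i \<noteq> 0" if "i < n" for i
    using card_field_power_inject[where 'a='a, of m i] that assms
    by (simp flip: of_nat_power)
  then have "real (card (mats_of_rank m n n :: 'a mat set)) \<noteq> 0"
    unfolding card_mats_of_full_col_rank by simp
  then show ?thesis by auto
qed

lemma mats_of_full_row_rank_nonempty:
  assumes "l \<le> m"
  shows "(mats_of_rank l m l :: 'a::{field,finite} mat set) \<noteq> {}"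
proof -
  let ?A = "append_cols (1\<^sub>m l) (0\<^sub>m l (m - l)) :: 'a mat"
  let ?S = "1\<^sub>m l @\<^sub>r 0\<^sub>m (m - l) l :: 'a mat"
  have A: "?A \<in> carrier_mat l m"
    using append_cols_carrier[of "1\<^sub>m l" l l "0\<^sub>m l (m - l)" "m - l"] assms by simp
  have S: "?S \<in> carrier_mat m l"
    using carrier_append_rows[of "1\<^sub>m l" l l "0\<^sub>m (m - l) l" "m - l"] assms by simp
  have "?A * ?S = 1\<^sub>m l * 1\<^sub>m l + 0\<^sub>m l (m - l) * 0\<^sub>m (m - l) l"
    by (rule append_cols_mult_append_rows) (rule one_carrier_mat zero_carrier_mat)+
  also have "\<dots> = 1\<^sub>m l" by simp
  finally have "mat_range ?A = carrier_vec l" by (rule mat_range_right_inverse[OF A S])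
  then have "?A \<in> mats_of_rank l m l" using A by (simp add: mats_of_full_row_rank_iff)
  then show ?thesis by blast
qed

text \<open>Bounds the ranks that can occur, which gives the range of the summation over
  \<open>r\<close>.\<close>

lemma rank_mult_le:
  fixes A :: "'a::{field,finite} mat"
  assumes A: "A \<in> carrier_mat l m" and D: "D \<in> mats_of_rank m b d"
  shows "vec_space.rank l (A * D) \<le> min l d"
proof -
  have Dc: "D \<in> carrier_mat m b" using D by (simp add: mats_of_rank_def)
  have AD: "A * D \<in> carrier_mat l b" using A Dc by simp
  have "CARD('a) ^ vec_space.rank l (A * D) \<le> CARD('a) ^ l"
    using card_mono[OF finite_carrier_vec mat_range_subset[OF AD]] card_mat_range[OF AD]
    by (simp add: card_carrier_vec)
  moreover have "CARD('a) ^ vec_space.rank l (A * D) \<le> CARD('a) ^ d"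
  proof -
    have "mat_range (A * D) = (\<lambda>v. A *\<^sub>v v) ` mat_range D"
      unfolding mat_range_def using A Dc by (auto simp: image_image intro!: image_cong)
    then have "card (mat_range (A * D)) \<le> card (mat_range D)"
      by (simp add: card_image_le finite_mat_range)
    then show ?thesis using card_mat_range[OF AD] D by (simp add: mats_of_rank_eq_card_range)
  qed
  ultimately show ?thesis using card_ge_2[where 'a='a] by simp
qed

text \<open>Group the matrices \<open>A\<close> by the rank \<open>r\<close> of
  \<open>A * D\<close>. The number of \<open>B\<close> depends only on the kernel size
  \<open>CARD('a) ^ (m - r)\<close>, and the size of each group is known from
  \<open>card_full_row_rank_mult_of_rank\<close>.\<close>

lemma sum_card_annihilated:
  fixes D :: "'a::{field,finite} mat"
  assumes D: "D \<in> mats_of_rank m m d"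
  shows "(\<Sum>A\<in>mats_of_rank l m l. real (card {B \<in> mats_of_rank m n n. A * D * B = 0\<^sub>m l n})) =
    (\<Sum>r = 0..min l d. real (card (mats_of_rank l d r :: 'a mat set)) *
      real (card (mats_of_rank (l - r) (m - d) (l - r) :: 'a mat set)) * real CARD('a) ^ ((m - d) * r) *
      (\<Prod>i = 0..<n. real CARD('a) ^ (m - r) - real CARD('a) ^ i))"
proof -
  have Dc: "D \<in> carrier_mat m m" using D by (simp add: mats_of_rank_def)
  let ?A = "mats_of_rank l m l :: 'a mat set"
  let ?g = "\<lambda>A. real (card {B \<in> mats_of_rank m n n. A * D * B = 0\<^sub>m l n})"
  let ?h = "\<lambda>r. \<Prod>i = 0..<n. real CARD('a) ^ (m - r) - real CARD('a) ^ i"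
  have "(\<Sum>A\<in>?A. ?g A) = (\<Sum>r = 0..min l d. \<Sum>A\<in>{A \<in> ?A. vec_space.rank l (A * D) = r}. ?g A)"
  proof (rule sum.group[symmetric])
    show "(\<lambda>A. vec_space.rank l (A * D)) ` ?A \<subseteq> {0..min l d}"
      using rank_mult_le[OF _ D, of _ l] by (auto simp: mats_of_rank_def)
  qed (simp_all add: finite_mats_of_rank)
  also have "\<dots> = (\<Sum>r = 0..min l d. real (card {A \<in> ?A. A * D \<in> mats_of_rank l m r}) * ?h r)"
  proof (rule sum.cong[OF refl])
    fix r
    have eq: "{A \<in> ?A. vec_space.rank l (A * D) = r} = {A \<in> ?A. A * D \<in> mats_of_rank l m r}"
      using Dc by (auto simp: mats_of_rank_def)
    have "?g A = ?h r" if "A \<in> {A \<in> ?A. A * D \<in> mats_of_rank l m r}" for A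
    proof -
      have AD: "A * D \<in> carrier_mat l m" and r: "card (mat_range (A * D)) = CARD('a) ^ r"
        using that by (auto simp: mats_of_rank_eq_card_range)
      show ?thesis
        unfolding card_full_col_rank_annihilated[OF AD] card_mat_kernel(2)[OF AD r] by simp
    qed
    then show "(\<Sum>A\<in>{A \<in> ?A. vec_space.rank l (A * D) = r}. ?g A) =
        real (card {A \<in> ?A. A * D \<in> mats_of_rank l m r}) * ?h r"
      unfolding eq by simp
  qed
  also have "\<dots> = (\<Sum>r = 0..min l d. real (card (mats_of_rank l d r :: 'a mat set)) *
      real (card (mats_of_rank (l - r) (m - d) (l - r) :: 'a mat set)) * real CARD('a) ^ ((m - d) * r) * ?h r)"
    by (simp add: card_full_row_rank_mult_of_rank[OF D] mult.assoc)
  finally show ?thesis .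
qed

section \<open>From solutions of the permuted kernel problem to annihilated pairs\<close>

lemma bij_betw_comp_sym_group:
  assumes p: "p \<in> sym_group m"
  shows "bij_betw (\<lambda>s. s \<circ> p) (sym_group m) (sym_group m)"
proof (rule bij_betw_byWitness[where f' = "\<lambda>s. s \<circ> inv_into UNIV p"])
  have perm: "p permutes {..<m}" using p by (simp add: sym_group_def)
  show "\<forall>s\<in>sym_group m. s \<circ> p \<circ> inv_into UNIV p = s" "\<forall>s\<in>sym_group m. s \<circ> inv_into UNIV p \<circ> p = s"
    by (simp_all add: comp_assoc permutes_inv_o[OF perm])
  show "(\<lambda>s. s \<circ> p) ` sym_group m \<subseteq> sym_group m"
    "(\<lambda>s. s \<circ> inv_into UNIV p) ` sym_group m \<subseteq> sym_group m"
    using permutes_compose[OF perm] permutes_compose[OF permutes_inv[OF perm]]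
    by (auto simp: sym_group_def)
qed

lemma bij_betw_mult_perm_mat:
  assumes p: "p \<in> sym_group m"
  shows "bij_betw (\<lambda>A. A * perm_mat m p) (mats_of_rank l m l) (mats_of_rank l m l :: 'a::{field,finite} mat set)"
proof -
  have perm: "p permutes {..<m}" using p by (simp add: sym_group_def)
  let ?P = "perm_mat m p :: 'a mat"
  note inv = perm_mat_inverse[OF perm, where 'a='a]
  have surj: "mat_range ?P = carrier_vec m"
    by (rule mat_range_right_inverse[OF perm_mat_carrier perm_mat_carrier inv(1)])
  have "bij_betw (\<lambda>A. A * ?P) {A \<in> carrier_mat l m. A \<in> mats_of_rank l m l}
      {A \<in> carrier_mat l m. A \<in> mats_of_rank l m l}"
  proof (rule bij_betw_Collect[OF bij_betw_mult_right[OF perm_mat_carrier perm_mat_carrier inv]])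
    fix A :: "'a mat" assume A: "A \<in> carrier_mat l m"
    then have "A * ?P \<in> carrier_mat l m" using perm_mat_carrier by (rule mult_carrier_mat)
    then show "A * ?P \<in> mats_of_rank l m l \<longleftrightarrow> A \<in> mats_of_rank l m l"
      using A mat_range_mult_surj[OF A perm_mat_carrier surj] by (simp add: mats_of_rank_eq_card_range)
  qed
  moreover have "{A \<in> carrier_mat l m. A \<in> mats_of_rank l m l} = (mats_of_rank l m l :: 'a mat set)"
    by (auto simp: mats_of_rank_def)
  ultimately show ?thesis by simp
qed

text \<open>Every candidate is uniquely \<open>s \<circ> p\<close>, with matrix
  \<open>perm_mat m p * perm_mat m s\<close>. Subtracting the known solution, which is the case of
  the identity \<open>s\<close>, turns the equation into a homogeneous one.\<close>

lemma N_sol_eq_card_annihilators: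
  fixes A :: "'a::field mat"
  assumes A: "A \<in> carrier_mat l m" and B: "B \<in> carrier_mat m n" and p: "p \<in> sym_group m"
  shows "N_sol A B (A * perm_mat m p * B) =
    card {s \<in> sym_group m. A * perm_mat m p * (perm_mat m s - 1\<^sub>m m) * B = 0\<^sub>m l n}"
proof -
  have perm: "p permutes {..<m}" using p by (simp add: sym_group_def)
  let ?A = "A * perm_mat m p"
  have A': "?A \<in> carrier_mat l m" using A perm_mat_carrier by (rule mult_carrier_mat)
  have "bij_betw (\<lambda>s. s \<circ> p) {s \<in> sym_group m. ?A * (perm_mat m s - 1\<^sub>m m) * B = 0\<^sub>m l n}
      {s \<in> sym_group m. A * perm_mat m s * B = ?A * B}"
  proof (rule bij_betw_Collect[OF bij_betw_comp_sym_group[OF p]])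
    fix s assume "s \<in> sym_group m"
    then have s: "s permutes {..<m}" by (simp add: sym_group_def)
    have "A * perm_mat m (s \<circ> p) = A * (perm_mat m p * perm_mat m s)"
      unfolding perm_mat_mult[OF perm s] ..
    also have "\<dots> = ?A * perm_mat m s" by (rule assoc_mult_mat[OF A perm_mat_carrier perm_mat_carrier, symmetric])
    finally have 1: "A * perm_mat m (s \<circ> p) = ?A * perm_mat m s" .
    have AS: "?A * perm_mat m s \<in> carrier_mat l m" using A' perm_mat_carrier by (rule mult_carrier_mat)
    have "?A * (perm_mat m s - 1\<^sub>m m) = ?A * perm_mat m s - ?A * 1\<^sub>m m"
      by (rule mult_minus_distrib_mat[OF A' perm_mat_carrier one_carrier_mat])
    then have "?A * (perm_mat m s - 1\<^sub>m m) = ?A * perm_mat m s - ?A" using right_mult_one_mat[OF A'] by simp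
    then have 2: "?A * (perm_mat m s - 1\<^sub>m m) * B = ?A * perm_mat m s * B - ?A * B"
      using minus_mult_distrib_mat[OF AS A' B] by simp
    have c: "?A * perm_mat m s * B \<in> carrier_mat l n" "?A * B \<in> carrier_mat l n"
      by (rule mult_carrier_mat[OF AS B], rule mult_carrier_mat[OF A' B])
    have "X - Y = 0\<^sub>m l n \<longleftrightarrow> X = Y" if "X \<in> carrier_mat l n" "Y \<in> carrier_mat l n" for X Y :: "'a mat"
      using that by (auto simp: mat_eq_iff)
    then show "A * perm_mat m (s \<circ> p) * B = ?A * B \<longleftrightarrow> ?A * (perm_mat m s - 1\<^sub>m m) * B = 0\<^sub>m l n"
      unfolding 1 2 using c by blast
  qed
  then show ?thesis using A by (simp add: N_sol_def bij_betw_same_card)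
qed

text \<open>Replacing \<open>A * perm_mat m p\<close> by \<open>A\<close> removes the secret
  permutation, so the sum is the same for every \<open>p\<close>.\<close>

lemma sum_N_sol:
  assumes p: "p \<in> sym_group m"
  shows "(\<Sum>A\<in>(mats_of_rank l m l :: 'a::{field,finite} mat set). \<Sum>B\<in>mats_of_rank m n n.
      real (N_sol A B (A * perm_mat m p * B))) =
    (\<Sum>s\<in>sym_group m. \<Sum>A\<in>(mats_of_rank l m l :: 'a mat set).
      real (card {B \<in> mats_of_rank m n n. A * (perm_mat m s - 1\<^sub>m m) * B = 0\<^sub>m l n}))"
proof -
  let ?A = "mats_of_rank l m l :: 'a mat set" and ?B = "mats_of_rank m n n :: 'a mat set"
  let ?Z = "\<lambda>A B s. A * (perm_mat m s - 1\<^sub>m m) * B = 0\<^sub>m l n"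
  have "(\<Sum>A\<in>?A. \<Sum>B\<in>?B. real (N_sol A B (A * perm_mat m p * B))) =
      (\<Sum>A\<in>?A. \<Sum>B\<in>?B. real (card {s \<in> sym_group m. ?Z (A * perm_mat m p) B s}))"
    by (intro sum.cong refl, subst N_sol_eq_card_annihilators[OF _ _ p]) (auto simp: mats_of_rank_def)
  also have "\<dots> = (\<Sum>A\<in>?A. \<Sum>B\<in>?B. real (card {s \<in> sym_group m. ?Z A B s}))"
    by (rule sum.reindex_bij_betw[OF bij_betw_mult_perm_mat[OF p]])
  \<comment> \<open>Cardinalities are written as sums of indicators, so that the count of
    \<open>s\<close> for fixed \<open>B\<close> can be exchanged for the count of \<open>B\<close>
    for fixed \<open>s\<close>.\<close>
  also have "\<dots> = (\<Sum>A\<in>?A. \<Sum>B\<in>?B. \<Sum>s\<in>sym_group m. if ?Z A B s then 1 else 0)"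
    using finite_sym_group[of m] by (simp add: sum.If_cases Int_def)
  also have "\<dots> = (\<Sum>A\<in>?A. \<Sum>s\<in>sym_group m. \<Sum>B\<in>?B. if ?Z A B s then 1 else 0)"
    by (intro sum.cong refl sum.swap)
  also have "\<dots> = (\<Sum>s\<in>sym_group m. \<Sum>A\<in>?A. \<Sum>B\<in>?B. if ?Z A B s then 1 else 0)"
    by (rule sum.swap)
  also have "\<dots> = (\<Sum>s\<in>sym_group m. \<Sum>A\<in>?A. real (card {B \<in> ?B. ?Z A B s}))"
    by (simp add: sum.If_cases Int_def finite_mats_of_rank)
  finally show ?thesis .
qed

text \<open>The expectation is an iterated average over three finite sets; the bounds on
  \<open>l\<close> and \<open>n\<close> ensure that they are nonempty.\<close>

lemma expectation_GenIPKP: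
  fixes f :: "'a::{field,finite} mat \<Rightarrow> 'a mat \<Rightarrow> 'a mat \<Rightarrow> (nat \<Rightarrow> nat) \<Rightarrow> real"
  assumes "l \<le> m" "n \<le> m"
  shows "measure_pmf.expectation (GenIPKP l m n) (\<lambda>(A, B, C, p). f A B C p) =
    (\<Sum>p\<in>sym_group m. \<Sum>A\<in>mats_of_rank l m l. \<Sum>B\<in>mats_of_rank m n n. f A B (A * perm_mat m p * B) p) /
    (real (card (sym_group m)) * real (card (mats_of_rank l m l :: 'a mat set)) *
     real (card (mats_of_rank m n n :: 'a mat set)))"
proof -
  let ?A = "mats_of_rank l m l :: 'a mat set" and ?B = "mats_of_rank m n n :: 'a mat set"
  let ?f = "\<lambda>A B p. f A B (A * perm_mat m p * B) p"
  note fin = finite_mats_of_rank[where 'a='a] finite_sym_group[of m]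
  note ne = mats_of_full_row_rank_nonempty[OF assms(1), where 'a='a]
    mats_of_full_col_rank_nonempty[OF assms(2), where 'a='a] sym_group_nonempty[of m]
  have "measure_pmf.expectation (GenIPKP l m n) (\<lambda>(A, B, C, p). f A B C p) =
      (\<Sum>A\<in>?A. (\<Sum>B\<in>?B. (\<Sum>p\<in>sym_group m. ?f A B p / real (card (sym_group m))) / real (card ?B)) /
        real (card ?A))"
    unfolding GenIPKP_def by (simp add: pmf_expectation_bind_pmf_of_set fin ne divide_inverse mult.commute)
  also have "\<dots> = (\<Sum>A\<in>?A. \<Sum>B\<in>?B. \<Sum>p\<in>sym_group m. ?f A B p) /
      (real (card (sym_group m)) * real (card ?A) * real (card ?B))"
    by (simp add: sum_divide_distrib mult_ac)
  also have "(\<Sum>A\<in>?A. \<Sum>B\<in>?B. \<Sum>p\<in>sym_group m. ?f A B p) = (\<Sum>A\<in>?A. \<Sum>p\<in>sym_group m. \<Sum>B\<in>?B. ?f A B p)"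
    by (intro sum.cong refl sum.swap)
  also have "\<dots> = (\<Sum>p\<in>sym_group m. \<Sum>A\<in>?A. \<Sum>B\<in>?B. ?f A B p)"
    by (rule sum.swap)
  finally show ?thesis .
qed

theorem theorem1:
  fixes q l m n :: nat
  assumes "CARD('a::{field,finite}) = q"
    and "l > 0" and "m > 0" and "n > 0" and "max l n \<le> m"
  shows "measure_pmf.expectation (GenIPKP l m n)
           (\<lambda>(A :: 'a mat, B, C, p). real (N_sol A B C)) =
         (\<Sum>k = 1..m. real (card (sym_group_cycles m k)) *
           (\<Sum>r = 0..min l (m - k).
             real (card (mats_of_rank l (m - k) r :: 'a mat set)) *
             real (card (mats_of_rank (l - r) k (l - r) :: 'a mat set)) * real q ^ (k * r) /
             real (card (mats_of_rank l m l :: 'a mat set)) *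
             (\<Prod>i = 0..<n. (real q ^ (m - r) - real q ^ i) / (real q ^ m - real q ^ i))))"
proof -
  let ?A = "mats_of_rank l m l :: 'a mat set" and ?B = "mats_of_rank m n n :: 'a mat set"
  let ?a = "real (card ?A)" and ?b = "real (card ?B)"
  define G where "G s = (\<Sum>A\<in>?A. real (card {B \<in> ?B. A * (perm_mat m s - 1\<^sub>m m) * B = 0\<^sub>m l n}))" for s
  let ?t = "\<lambda>k r. real (card (mats_of_rank l (m - k) r :: 'a mat set)) *
      real (card (mats_of_rank (l - r) k (l - r) :: 'a mat set)) * real q ^ (k * r)"
  let ?h = "\<lambda>r. \<Prod>i = 0..<n. real q ^ (m - r) - real q ^ i"
  define S where "S k = (\<Sum>r = 0..min l (m - k). ?t k r * ?h r)" for k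
  have lm: "l \<le> m" and nm: "n \<le> m" using assms(5) by auto
  have card_sym: "real (card (sym_group m)) \<noteq> 0"
    using finite_sym_group sym_group_nonempty by (simp add: card_eq_0_iff)
  have "measure_pmf.expectation (GenIPKP l m n) (\<lambda>(A :: 'a mat, B, C, p). real (N_sol A B C)) =
      (\<Sum>p\<in>sym_group m. \<Sum>s\<in>sym_group m. G s) / (real (card (sym_group m)) * ?a * ?b)"
    unfolding expectation_GenIPKP[OF lm nm] G_def by (simp add: sum_N_sol)
  \<comment> \<open>The inner sum is free of \<open>p\<close>, so averaging over \<open>p\<close>
    cancels the order of the group.\<close>
  also have "\<dots> = (\<Sum>s\<in>sym_group m. G s) / (?a * ?b)"
    using card_sym by (simp add: mult.assoc)
  also have "(\<Sum>s\<in>sym_group m. G s) = (\<Sum>k = 1..m. \<Sum>s\<in>sym_group_cycles m k. G s)"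
    unfolding sym_group_eq_Union_cycles[OF assms(3)]
  proof (rule sum.UNION_disjoint)
    have "sym_group_cycles m k \<subseteq> sym_group m" for k by (auto simp: sym_group_cycles_def)
    then show "\<forall>k\<in>{1..m}. finite (sym_group_cycles m k)"
      using finite_subset[OF _ finite_sym_group] by blast
    show "\<forall>k\<in>{1..m}. \<forall>k'\<in>{1..m}. k \<noteq> k' \<longrightarrow> sym_group_cycles m k \<inter> sym_group_cycles m k' = {}"
      using sym_group_cycles_unique by blast
  qed simp
  also have "\<dots> = (\<Sum>k = 1..m. real (card (sym_group_cycles m k)) * S k)"
  proof -
    \<comment> \<open>The matrix \<open>perm_mat m s - 1\<^sub>m m\<close> has rank
      \<open>d = m - k\<close>, and \<open>m - d = k\<close> because
      \<open>k \<le> m\<close>.\<close>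
    have "G s = S k" if "k \<in> {1..m}" "s \<in> sym_group_cycles m k" for k s
      using sum_card_annihilated[OF perm_mat_minus_one_rank[OF that(2), where 'a='a], of n l] that(1) assms(1)
      by (simp add: G_def S_def)
    then show ?thesis by simp
  qed
  also have "\<dots> / (?a * ?b) = (\<Sum>k = 1..m. real (card (sym_group_cycles m k)) * (S k / (?a * ?b)))"
    by (simp add: sum_divide_distrib)
  \<comment> \<open>Only the count of \<open>B\<close> is expanded into a product; dividing factor
    by factor gives the quotients of the claim.\<close>
  also have "?b = (\<Prod>i = 0..<n. real q ^ m - real q ^ i)"
    unfolding card_mats_of_full_col_rank assms(1) ..
  finally show ?thesis by (simp add: S_def sum_divide_distrib prod_dividef)
qed

end
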